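(* Let $p,q\in[1,\infty]$, with conjugate exponents $p',q'$. There exists a constant $C_{p,q}\in(0,\infty)$ such that for every positive integer $d$ and every $g\in\mathrm{L}^{q'}(\mathbb{T}^d)$ one has \[ \big\|\widehat{g}\big|_{\{0,1\}^d}\big\|_{\ell^{p'}(\{0,1\}^d)} \leq C_{p,q} \|g\|_{\mathrm{L}^{q'}(\mathbb{T}^d)} \] if and only if $p$ and $q$ satisfy \[ \frac{1}{p} \geq \begin{cases} 1 & \text{for } q=\infty, \\ \displaystyle\frac{1}{q}\log_2\binom{q}{q/2} & \text{for } q\in[2,\infty), \\ \displaystyle\frac{1}{2} & \text{for } q\in[1,2). \end{cases} \]
   Context: $\mathbb{T}^d=(\mathbb{R}/\mathbb{Z})^d$ carries the Haar probability measure $\mathrm{d}\xi$. For $g\in\mathrm{L}^1(\mathbb{T}^d)$, $\widehat{g}\colon\mathbb{Z}^d\to\mathbb{C}$ is $\widehat{g}(x):=\int_{\mathbb{T}^d} g(\xi)e^{-2\pi i x\cdot\xi}\,\mathrm{d}\xi$. Conjugate exponents satisfy $1/p+1/p'=1$, $1/q+1/q'=1$, with the convention $1/\infty=0$. The $\ell^{p'}$ norm is with respect to counting measure. The constant $C_{p,q}$ may depend on $p,q$ but not on $d$ or $g$. The generalized binomial coefficient is $\binom{a}{b}:=\frac{\Gamma(a+1)}{\Gamma(b+1)\Gamma(a-b+1)}$ for real $a,b$ with $\min\{a,b,a-b\}>-1$. *)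

theory Defs
  imports "HOL-Probability.Probability"
begin

text \<open>
  The torus of dimension \<open>d\<close> is represented by its fundamental domain \<open>[0,1)^d\<close>, with coordinates
  indexed by \<open>{..<d}\<close>. Functions on the torus are exactly the functions on this domain (equivalently,
  the functions that are 1-periodic in each coordinate), and Haar probability measure is the
  product Lebesgue measure on it.
\<close>

definition torus :: "nat \<Rightarrow> (nat \<Rightarrow> real) measure" where
  "torus d = (\<Pi>\<^sub>M i\<in>{..<d}. restrict_space lborel {0..<1})"

definition fourier_coeff :: "nat \<Rightarrow> ((nat \<Rightarrow> real) \<Rightarrow> complex) \<Rightarrow> (nat \<Rightarrow> int) \<Rightarrow> complex" where
  "fourier_coeff d g x =
     (LINT \<xi>|torus d. g \<xi> * exp (- 2 * of_real pi * \<i> * of_real (\<Sum>i<d. of_int (x i) * \<xi> i)))"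

definition cube :: "nat \<Rightarrow> (nat \<Rightarrow> int) set" where
  "cube d = ({..<d} \<rightarrow>\<^sub>E {0, 1})"

text \<open>
  \<open>Lp_space\<close> consists of functions rather than almost-everywhere classes. The exponent is meant to
  lie in \<open>[1,\<infinity>]\<close>, with \<open>\<top>\<close> in the role of \<open>\<infinity>\<close>, and \<open>Lp_norm\<close> is meaningful only on \<open>Lp_space\<close>
  (elsewhere the real-valued expressions take default values). Over a counting measure these
  are the \<open>\<ell>\<^sup>p\<close> space and norm.
\<close>

definition Lp_space :: "'a measure \<Rightarrow> ennreal \<Rightarrow> ('a \<Rightarrow> complex) set" where
  "Lp_space M p = {f \<in> borel_measurable M.
     if p = \<top> then esssup M (\<lambda>x. ennreal (norm (f x))) < \<top>
     else integrable M (\<lambda>x. norm (f x) powr enn2real p)}"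

definition Lp_norm :: "'a measure \<Rightarrow> ennreal \<Rightarrow> ('a \<Rightarrow> complex) \<Rightarrow> real" where
  "Lp_norm M p f =
     (if p = \<top> then enn2real (esssup M (\<lambda>x. ennreal (norm (f x))))
      else (LINT x|M. norm (f x) powr enn2real p) powr (1 / enn2real p))"

text \<open>Intended for \<open>a\<close>, \<open>b\<close> and \<open>a - b\<close> all greater than \<open>-1\<close>.\<close>

definition gen_binomial :: "real \<Rightarrow> real \<Rightarrow> real" where
  "gen_binomial a b = Gamma (a + 1) / (Gamma (b + 1) * Gamma (a - b + 1))"

end

theory Submission
  imports Defs
begin

text \<open>
  By duality the estimate says that a polynomial \<open>\<Sum>\<^sub>x f(x) e(-x\<cdot>\<xi>)\<close> with frequencies in the cube has
  \<open>L\<^sup>q\<close> norm at most \<open>C \<parallel>f\<parallel>\<^sub>p\<close>. For \<open>q \<ge> 2\<close> Minkowski's inequality (\<open>p \<le> q\<close>) reduces this, with a constant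
  that does not grow, to the one-dimensional inequality
  \<open>\<integral> \<bar>1 + z e(-\<xi>)\<bar>\<^sup>q \<le> (1 + \<bar>z\<bar>\<^sup>p)\<^bsup>q/p\<^esup>\<close>; for \<open>q < 2\<close> one compares with \<open>q = 2\<close>.

  With \<open>a = q/2\<close>, \<open>r = p/2\<close>, \<open>s = \<bar>z\<bar>\<^sup>2\<close> the integral is \<open>F(s) = \<Sum>\<^sub>k (a choose k)\<^sup>2 s\<^sup>k\<close>, which satisfies a
  hypergeometric equation. The function \<open>G = ln F - (a/r) ln (1 + s\<^sup>r)\<close> vanishes at \<open>0\<close>, is negative for small \<open>s\<close>
  and is nonpositive at \<open>1\<close> by the condition on \<open>p\<close>, as \<open>F(1)\<close> is the binomial coefficient \<open>(q choose q/2)\<close>. At a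
  critical point the equation gives \<open>G''\<close> the sign of \<open>a (s\<^bsup>1-r\<^esup> - s\<^sup>r)/(1 - s) - r\<close>, which is strictly increasing
  in \<open>s\<close>. A positive maximum of \<open>G\<close> would come after a negative minimum, and this is incompatible with
  that monotonicity.

  Conversely, taking \<open>d\<close>-fold products of one function \<open>\<gamma>\<close> and letting \<open>d \<rightarrow> \<infinity>\<close> turns the estimate into
  the one-dimensional one with constant \<open>1\<close>. It is tested on \<open>1 + i t sin 2\<pi>\<xi>\<close> for small \<open>t\<close>, on
  \<open>1 + cos 2\<pi>\<xi>\<close> if \<open>q = \<infinity>\<close>, and on the dual extremiser \<open>\<bar>w\<bar>\<^bsup>q-2\<^esup> cnj w\<close> of \<open>w = 1 + e(-\<xi>)\<close>.
\<close>

subsection \<open>Second-derivative test and the hypergeometric series\<close>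

lemma interior_max_deriv_zero:
  fixes G G' :: "real \<Rightarrow> real"
  assumes x: "\<alpha> < x" "x < \<beta>"
    and G: "(G has_real_derivative D) (at x)"
    and mx: "\<And>y. \<alpha> < y \<Longrightarrow> y < \<beta> \<Longrightarrow> G y \<le> G x"
  shows "D = 0"
proof (rule DERIV_local_max[OF G])
  show "0 < min (x - \<alpha>) (\<beta> - x)" using x by auto
  show "\<forall>y. \<bar>x - y\<bar> < min (x - \<alpha>) (\<beta> - x) \<longrightarrow> G y \<le> G x"
    using mx by auto
qed

text \<open>\<open>G'\<close> vanishes at the maximum, so \<open>D > 0\<close> would make
  \<open>G'\<close> positive just to the right of \<open>x\<close>, and \<open>G\<close> would
  increase there. \<open>G'\<close> is differentiated at \<open>x\<close> alone, because the second
  derivative is later computed only at critical points.\<close>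

lemma interior_max_second_deriv_nonpos:
  fixes G G' :: "real \<Rightarrow> real"
  assumes x: "\<alpha> < x" "x < \<beta>"
    and G: "\<And>y. \<alpha> < y \<Longrightarrow> y < \<beta> \<Longrightarrow> (G has_real_derivative G' y) (at y)"
    and D: "(G' has_real_derivative D) (at x)"
    and mx: "\<And>y. \<alpha> < y \<Longrightarrow> y < \<beta> \<Longrightarrow> G y \<le> G x"
  shows "D \<le> 0"
proof (rule ccontr)
  have 0: "G' x = 0" using interior_max_deriv_zero[OF x G[OF x] mx] .
  assume "\<not> D \<le> 0"
  then have "D > 0" by simp
  from DERIV_pos_inc_right[OF D this] obtain d where d: "d > 0"
    "\<And>h. 0 < h \<Longrightarrow> h < d \<Longrightarrow> G' x < G' (x + h)" by auto
  define y where "y = x + min (d / 2) ((\<beta> - x) / 2)"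
  have y: "x < y" "y < \<beta>" "y < x + d" using d(1) x by (auto simp: y_def min_def field_simps)
  have "G x < G y"
  proof (rule DERIV_pos_imp_increasing_open[OF y(1)])
    fix t assume t: "x < t" "t < y"
    have "(G has_real_derivative G' t) (at t)" using G t x y by auto
    moreover have "G' t > 0" using d(2)[of "t - x"] t y 0 by auto
    ultimately show "\<exists>y. (G has_real_derivative y) (at t) \<and> 0 < y" by blast
  next
    show "continuous_on {x..y} G"
      using G x y by (auto intro!: continuous_at_imp_continuous_on DERIV_isCont[OF G])
  qed
  with mx[of y] y x show False by auto
qed

text \<open>The Euler operator s d/ds multiplies the k-th coefficient by \<open>k\<close> without
  shifting the index. The form \<open>s * D\<close> covers \<open>s = 0\<close> without a
  division.\<close>

lemma power_series_theta_deriv: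
  fixes b :: "nat \<Rightarrow> real"
  assumes "\<And>s. \<bar>s\<bar> < 1 \<Longrightarrow> summable (\<lambda>k. b k * s ^ k)" and s: "\<bar>s\<bar> < 1"
  shows "summable (\<lambda>k. (real k * b k) * s ^ k)"
    and "\<exists>D. ((\<lambda>s. \<Sum>k. b k * s ^ k) has_real_derivative D) (at s) \<and> s * D = (\<Sum>k. (real k * b k) * s ^ k)"
proof -
  have sd: "summable (\<lambda>k. diffs b k * s ^ k)"
    by (rule termdiff_converges[of _ 1]) (use assms in auto)
  have "(\<lambda>k. real k * b k * s ^ (k - Suc 0)) sums (\<Sum>k. diffs b k * s ^ k)"
    using diffs_equiv[OF sd] by simp
  from sums_mult[OF this, of s]
  have "(\<lambda>k. s * (real k * b k * s ^ (k - Suc 0))) sums (s * (\<Sum>k. diffs b k * s ^ k))" .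
  moreover have "s * (real k * b k * s ^ (k - Suc 0)) = (real k * b k) * s ^ k" for k
    by (cases k) auto
  ultimately have *: "(\<lambda>k. (real k * b k) * s ^ k) sums (s * (\<Sum>k. diffs b k * s ^ k))"
    by simp
  then show "summable (\<lambda>k. (real k * b k) * s ^ k)" by (rule sums_summable)
  have "((\<lambda>s. \<Sum>k. b k * s ^ k) has_real_derivative (\<Sum>k. diffs b k * s ^ k)) (at s)"
    by (rule termdiffs_strong'[of 1]) (use assms in auto)
  with * show "\<exists>D. ((\<lambda>s. \<Sum>k. b k * s ^ k) has_real_derivative D) (at s) \<and> s * D = (\<Sum>k. (real k * b k) * s ^ k)"
    by (auto simp: sums_iff)
qed

lemma summable_abs_gbinomial_power:
  fixes a :: real
  assumes "\<bar>t\<bar> < 1"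
  shows "summable (\<lambda>k. \<bar>a gchoose k\<bar> * \<bar>t\<bar> ^ k)"
proof -
  have "ereal (norm t) < conv_radius (\<lambda>n. a gchoose n)"
    unfolding conv_radius_gchoose using assms by (auto simp: one_ereal_def)
  from abs_summable_in_conv_radius[OF this] show ?thesis
    by (simp add: abs_mult power_abs)
qed

text \<open>With \<open>t = sqrt \<bar>s\<bar>\<close> each term has absolute value the square of
  \<open>\<bar>a gchoose k\<bar> * t ^ k\<close>. These numbers tend to 0, so eventually their
  squares are dominated by the numbers themselves, which are summable.\<close>

lemma summable_gbinomial_square_power:
  fixes a :: real
  assumes "\<bar>s\<bar> < 1"
  shows "summable (\<lambda>k. (a gchoose k)\<^sup>2 * s ^ k)"
proof -
  define t where "t = sqrt \<bar>s\<bar>"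
  have t: "0 \<le> t" "t < 1" "t\<^sup>2 = \<bar>s\<bar>" using assms by (auto simp: t_def)
  have sm: "summable (\<lambda>k. \<bar>a gchoose k\<bar> * t ^ k)"
    using summable_abs_gbinomial_power[of t a] t by simp
  then have "(\<lambda>k. \<bar>a gchoose k\<bar> * t ^ k) \<longlonglongrightarrow> 0" by (rule summable_LIMSEQ_zero)
  then have "eventually (\<lambda>k. \<bar>a gchoose k\<bar> * t ^ k < 1) sequentially"
    by (rule order_tendstoD) simp
  then have "eventually (\<lambda>k. norm ((a gchoose k)\<^sup>2 * s ^ k) \<le> \<bar>a gchoose k\<bar> * t ^ k) sequentially"
  proof eventually_elim
    case (elim k)
    have "norm ((a gchoose k)\<^sup>2 * s ^ k) = (\<bar>a gchoose k\<bar> * t ^ k)\<^sup>2"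
      by (simp add: abs_mult power_abs power_mult_distrib t(3)[symmetric] flip: power_mult)
         (simp add: mult.commute)
    also have "\<dots> \<le> \<bar>a gchoose k\<bar> * t ^ k"
      using elim t(1) by (simp add: power2_eq_square mult_left_le)
    finally show ?case .
  qed
  then show ?thesis using sm by (rule summable_comparison_test_ev)
qed

text \<open>The series is the Gauss function F(-a, -a; 1; s). \<open>S1\<close> and
  \<open>S2\<close> are its first and second images under the Euler operator E = s d/ds, and the
  fourth clause is E^2 F = s (E - a)^2 F, which encodes the coefficient recurrence
  \<open>rec\<close>. Differentiability at 0 serves to control the behaviour near 0.\<close>

lemma hypergeometric_series_ode:
  fixes a :: real
  obtains S0 S1 S2 :: "real \<Rightarrow> real" where
    "\<And>s. S0 s = (\<Sum>k. (a gchoose k)\<^sup>2 * s ^ k)"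
    "\<And>s. 0 < s \<Longrightarrow> s < 1 \<Longrightarrow> (S0 has_real_derivative S1 s / s) (at s)"
    "\<And>s. 0 < s \<Longrightarrow> s < 1 \<Longrightarrow> (S1 has_real_derivative S2 s / s) (at s)"
    "\<And>s. 0 < s \<Longrightarrow> s < 1 \<Longrightarrow> S2 s = s * (S2 s - 2 * a * S1 s + a\<^sup>2 * S0 s)"
    "\<And>s. 0 \<le> s \<Longrightarrow> s < 1 \<Longrightarrow> S0 s \<ge> 1"
    "\<exists>D. (S0 has_real_derivative D) (at 0)"
    "S0 0 = 1"
proof -
  define c where "c k = (a gchoose k)\<^sup>2" for k
  define S where "S j s = (\<Sum>k. real k ^ j * c k * s ^ k)" for j :: nat and s :: real
  have sm0: "summable (\<lambda>k. c k * s ^ k)" if "\<bar>s\<bar> < 1" for s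
    unfolding c_def using summable_gbinomial_square_power[OF that] .
  have sm: "summable (\<lambda>k. real k ^ j * c k * s ^ k)" if "\<bar>s\<bar> < 1" for s j
    using that
  proof (induction j arbitrary: s)
    case (Suc j)
    show ?case using power_series_theta_deriv(1)[OF Suc.IH Suc.prems] by (simp add: mult_ac)
  qed (use sm0 in simp)
  have der: "\<exists>D. (S j has_real_derivative D) (at s) \<and> s * D = S (Suc j) s" if "\<bar>s\<bar> < 1" for s j
    using power_series_theta_deriv(2)[OF sm that, of j] by (simp add: S_def[abs_def] mult_ac)
  have der': "(S j has_real_derivative S (Suc j) s / s) (at s)" if "0 < s" "s < 1" for s j
  proof -
    from der[of s j] that obtain D where "(S j has_real_derivative D) (at s)" "s * D = S (Suc j) s" by auto
    moreover from this(2) have "D = S (Suc j) s / s" using that by (simp add: nonzero_eq_divide_eq mult.commute)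
    ultimately show ?thesis by simp
  qed
  have c0: "c 0 = 1" by (simp add: c_def)
  have rec: "(real (Suc k))\<^sup>2 * c (Suc k) = (a - real k)\<^sup>2 * c k" for k
  proof -
    have "real (Suc k) * (a gchoose Suc k) = (a - real k) * (a gchoose k)"
      using gbinomial_mult_1[of a k] by (simp add: algebra_simps)
    then show ?thesis unfolding c_def power_mult_distrib[symmetric] by simp
  qed
  have ode: "S 2 s = s * (S 2 s - 2 * a * S 1 s + a\<^sup>2 * S 0 s)" if "0 < s" "s < 1" for s
  proof -
    have s: "\<bar>s\<bar> < 1" using that by simp
    have j: "(\<lambda>k. real k ^ j * c k * s ^ k) sums S j s" for j
      unfolding S_def using sm[OF s] by (rule summable_sums)
    have "(\<lambda>k. s * (real k ^ 2 * c k * s ^ k - 2 * a * (real k ^ 1 * c k * s ^ k) + a\<^sup>2 * (real k ^ 0 * c k * s ^ k)))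
            sums (s * (S 2 s - 2 * a * S 1 s + a\<^sup>2 * S 0 s))"
      by (intro sums_mult sums_add sums_diff j)
    also have "(\<lambda>k. s * (real k ^ 2 * c k * s ^ k - 2 * a * (real k ^ 1 * c k * s ^ k) + a\<^sup>2 * (real k ^ 0 * c k * s ^ k)))
       = (\<lambda>k. ((a - real k)\<^sup>2 * c k) * s ^ Suc k)"
      by (simp add: fun_eq_iff power2_eq_square algebra_simps)
    also have "\<dots> = (\<lambda>k. real (Suc k) ^ 2 * c (Suc k) * s ^ Suc k)" by (simp only: rec)
    \<comment> \<open>The index shift costs nothing, as the term with \<open>k = 0\<close> carries
      the factor 0.\<close>
    finally have "(\<lambda>k. real k ^ 2 * c k * s ^ k) sums (s * (S 2 s - 2 * a * S 1 s + a\<^sup>2 * S 0 s))"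
      by (subst (asm) sums_Suc_iff) simp
    from sums_unique2[OF j[of 2] this] show ?thesis .
  qed
  have ge1: "S 0 s \<ge> 1" if "0 \<le> s" "s < 1" for s
  proof -
    have "(\<Sum>k\<in>{0}. c k * s ^ k) \<le> (\<Sum>k. c k * s ^ k)"
      by (rule sum_le_suminf) (use sm0[of s] that in \<open>auto simp: c_def\<close>)
    then show ?thesis by (simp add: S_def c0)
  qed
  have S00: "S 0 0 = 1"
  proof -
    have "(\<Sum>k. c k * 0 ^ k) = c 0" by (rule powser_zero)
    then show ?thesis by (simp add: S_def c0)
  qed
  show ?thesis
    by (rule that[of "S 0" "S 1" "S 2"])
      (use der' der'[of _ 0] der'[of _ 1] ode ge1 der[of 0 0] S00 in \<open>auto simp: S_def c_def numeral_2_eq_2\<close>)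
qed

text \<open>The derivative of the ratio has the sign of \<open>?N\<close>. This numerator vanishes
  at 0, and its own derivative is (c^2 - 1/4) sinh(c z) sinh(z/2) < 0.\<close>

lemma sinh_ratio_strict_antimono:
  fixes c :: real
  assumes "0 < c" "c < 1/2" "0 < x" "x < y"
  shows "sinh (c * y) / sinh (y / 2) < sinh (c * x) / sinh (x / 2)"
proof -
  let ?N = "\<lambda>y. c * cosh (c * y) * sinh (y / 2) - sinh (c * y) * cosh (y / 2) / 2"
  have N: "?N t < 0" if "t > 0" for t
  proof -
    have "?N t < ?N 0"
    proof (rule DERIV_neg_imp_decreasing_open[OF that])
      fix z :: real assume z: "0 < z" "z < t"
      have "(?N has_real_derivative (c\<^sup>2 - 1/4) * (sinh (c * z) * sinh (z / 2))) (at z)"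
        by (auto intro!: derivative_eq_intros simp: field_simps power2_eq_square)
      moreover have "c * c < (1/2) * (1/2)" using assms by (intro mult_strict_mono) auto
      then have "(c\<^sup>2 - 1/4) * (sinh (c * z) * sinh (z / 2)) < 0"
        using z assms by (intro mult_neg_pos mult_pos_pos) (auto simp: power2_eq_square)
      ultimately show "\<exists>y. (?N has_real_derivative y) (at z) \<and> y < 0" by blast
    qed (auto intro!: continuous_intros)
    then show ?thesis by simp
  qed
  show ?thesis
  proof (rule DERIV_neg_imp_decreasing_open[OF assms(4)])
    fix z assume z: "x < z" "z < y"
    then have "z > 0" using assms by simp
    have "((\<lambda>z. sinh (c * z) / sinh (z / 2)) has_real_derivative ?N z / (sinh (z/2))\<^sup>2) (at z)"
      using \<open>z > 0\<close> by (auto intro!: derivative_eq_intros simp: field_simps power2_eq_square)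
    moreover have "?N z / (sinh (z/2))\<^sup>2 < 0"
      using N[OF \<open>z > 0\<close>] \<open>z > 0\<close> by (simp add: divide_neg_pos)
    ultimately show "\<exists>d. ((\<lambda>z. sinh (c * z) / sinh (z / 2)) has_real_derivative d) (at z) \<and> d < 0" by blast
  next
    show "continuous_on {x..y} (\<lambda>z. sinh (c * z) / sinh (z / 2))"
      using assms by (auto intro!: continuous_intros)
  qed
qed

text \<open>Putting s = exp(-y) and cancelling exp(-y/2) leaves sinh((r - 1/2) y) / sinh(y/2), and
  \<open>y\<close> decreases as \<open>s\<close> grows.\<close>

lemma powr_ratio_strict_mono:
  fixes r s1 s2 :: real
  assumes r: "1/2 < r" "r < 1" and s: "0 < s1" "s1 < s2" "s2 < 1"
  shows "(s1 powr (1 - r) - s1 powr r) / (1 - s1) < (s2 powr (1 - r) - s2 powr r) / (1 - s2)"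
proof -
  have *: "(s powr (1 - r) - s powr r) / (1 - s) = sinh ((r - 1/2) * (- ln s)) / sinh (- ln s / 2)"
    if "0 < s" "s < 1" for s :: real
  proof -
    define y where "y = - ln s"
    have "s = exp (- y)" using that by (simp add: y_def)
    then have e: "s powr (1 - r) = exp (- y / 2) * exp ((r - 1/2) * y)"
      "s powr r = exp (- y / 2) * exp (- ((r - 1/2) * y))"
      "1 = exp (- y / 2) * exp (y / 2)" "s = exp (- y / 2) * exp (- (y / 2))"
      by (simp_all add: powr_def mult_exp_exp) (simp_all add: algebra_simps)
    have "(s powr (1 - r) - s powr r) / (1 - s) =
       (exp (- y / 2) * (exp ((r - 1/2) * y) - exp (- ((r - 1/2) * y)))) /
       (exp (- y / 2) * (exp (y / 2) - exp (- (y / 2))))"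
      unfolding right_diff_distrib e(1,2) e(3)[symmetric] e(4)[symmetric] by (rule refl)
    also have "\<dots> = sinh ((r - 1/2) * y) / sinh (y / 2)"
      by (simp add: sinh_field_def del: left_diff_distrib_numeral right_diff_distrib_numeral)
    finally show ?thesis by (simp add: y_def)
  qed
  have "ln s1 < ln s2" "ln s2 < 0" using s by auto
  then show ?thesis using s r sinh_ratio_strict_antimono[of "r - 1/2" "- ln s2" "- ln s1"] by (simp add: * )
qed

text \<open>A positive maximum of \<open>G\<close> at \<open>s0\<close> and a negative minimum at an
  earlier \<open>s1\<close> would give \<open>a * \<rho> s0 \<le> r \<le> a * \<rho> s1\<close>,
  against the strict growth of \<open>\<rho>\<close>. The series represents \<open>\<Phi>\<close>
  below 1 only; continuity brings in the endpoint, where the bound is assumed.\<close>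

lemma hypergeometric_le_powr:
  fixes a r :: real and \<Phi> :: "real \<Rightarrow> real"
  assumes a: "0 < a" and r: "1/2 < r" "r < 1"
    and \<Phi>: "\<And>s. 0 \<le> s \<Longrightarrow> s < 1 \<Longrightarrow> \<Phi> s = (\<Sum>k. (a gchoose k)\<^sup>2 * s ^ k)"
    and cont: "continuous_on {0..1} \<Phi>"
    and one: "\<Phi> 1 \<le> 2 powr (a / r)"
    and s: "0 \<le> s" "s \<le> 1"
  shows "\<Phi> s \<le> (1 + s powr r) powr (a / r)"
proof -
  obtain S0 S1 S2 :: "real \<Rightarrow> real" where
    S0: "\<And>s. S0 s = (\<Sum>k. (a gchoose k)\<^sup>2 * s ^ k)"
    and dS0: "\<And>s. 0 < s \<Longrightarrow> s < 1 \<Longrightarrow> (S0 has_real_derivative S1 s / s) (at s)"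
    and dS1: "\<And>s. 0 < s \<Longrightarrow> s < 1 \<Longrightarrow> (S1 has_real_derivative S2 s / s) (at s)"
    and ode: "\<And>s. 0 < s \<Longrightarrow> s < 1 \<Longrightarrow> S2 s = s * (S2 s - 2 * a * S1 s + a\<^sup>2 * S0 s)"
    and ge1: "\<And>s. 0 \<le> s \<Longrightarrow> s < 1 \<Longrightarrow> S0 s \<ge> 1"
    and d0: "\<exists>D. (S0 has_real_derivative D) (at 0)" and S00: "S0 0 = 1"
    using hypergeometric_series_ode[of a] by blast
  have \<Phi>S: "\<Phi> s = S0 s" if "0 \<le> s" "s < 1" for s using \<Phi>[OF that] S0 by simp
  have "\<Phi> 1 \<ge> 1"
  proof (rule tendsto_lowerbound)
    show "(\<Phi> \<longlongrightarrow> \<Phi> 1) (at_left 1)"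
      using cont by (metis at_within_Icc_at_left continuous_on_def zero_less_one atLeastAtMost_iff order.refl zero_le_one)
    have "eventually (\<lambda>x::real. 0 < x) (at_left 1)"
      by (rule eventually_at_leftI[of 0]) auto
    moreover have "eventually (\<lambda>x::real. x < 1) (at_left 1)"
      by (simp add: eventually_at_filter)
    ultimately show "eventually (\<lambda>x. 1 \<le> \<Phi> x) (at_left 1)"
      by eventually_elim (use \<Phi>S ge1 in auto)
  qed simp
  then have pos: "\<Phi> s \<ge> 1" if "0 \<le> s" "s \<le> 1" for s
    using \<Phi>S[of s] ge1[of s] that by (cases "s = 1") auto
  have ppos: "1 + s powr r > 0" for s :: real by (simp add: add_pos_nonneg)
  define G where "G s = ln (\<Phi> s) - a / r * ln (1 + s powr r)" for s
  \<comment> \<open>\<open>v\<close> is s d/ds of ln(1 + s^r) / r, so that \<open>g s\<close> will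
    be s times the derivative of \<open>G\<close>.\<close>
  define v where "v s = s powr r / (1 + s powr r)" for s :: real
  define g where "g s = S1 s / S0 s - a * v s" for s
  have contG: "continuous_on {0..1} G"
    unfolding G_def using r pos ppos
    by (auto intro!: continuous_intros cont continuous_on_powr' simp: less_le_not_le dest: pos)
       (smt (verit) ppos pos)+
  have S0p: "S0 s > 0" if "0 < s" "s < 1" for s using ge1[of s] that by simp
  have dv: "(v has_real_derivative r * s powr r / (1 + s powr r)\<^sup>2 / s) (at s)" if "0 < s" for s
  proof -
    have "((\<lambda>s. s powr r) has_real_derivative r * s powr r / s) (at s)"
      using has_real_derivative_powr[OF that, of r] that by (simp add: powr_diff)
    from DERIV_divide[OF this DERIV_add[OF DERIV_const this, of 1]] ppos[of s]
    have "(v has_real_derivative (r * s powr r / s * (1 + s powr r) - s powr r * (0 + r * s powr r / s)) /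
        ((1 + s powr r) * (1 + s powr r))) (at s)"
      unfolding v_def[abs_def] by simp
    then show ?thesis
      by (rule DERIV_cong) (use that in \<open>simp add: divide_simps power2_eq_square, simp add: algebra_simps\<close>)
  qed
  have dG: "(G has_real_derivative g s / s) (at s)" if "0 < s" "s < 1" for s
  proof -
    have "((\<lambda>s. s powr r) has_real_derivative r * s powr r / s) (at s)"
      using has_real_derivative_powr[OF that(1), of r] that by (simp add: powr_diff)
    note P = this
    have 1: "((\<lambda>s. a / r * ln (1 + s powr r)) has_real_derivative a / r * (1 / (1 + s powr r) * (0 + r * s powr r / s))) (at s)"
      using DERIV_cmult[OF DERIV_chain2[OF DERIV_ln_divide[OF ppos[of s]] DERIV_add[OF DERIV_const[of 1] P]], of "a / r"] .
    have "((\<lambda>s. ln (S0 s)) has_real_derivative 1 / S0 s * (S1 s / s)) (at s)"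
      using DERIV_chain2[OF DERIV_ln_divide[OF S0p[OF that]] dS0[OF that]] .
    from DERIV_diff[OF this 1]
    have "((\<lambda>s. ln (S0 s) - a / r * ln (1 + s powr r)) has_real_derivative g s / s) (at s)"
      using r that ppos[of s] S0p[OF that] by (simp add: g_def v_def diff_divide_distrib mult.commute)
    then show ?thesis
    proof (rule DERIV_cong_ev[THEN iffD1, rotated -1])
      show "eventually (\<lambda>s. ln (S0 s) - a / r * ln (1 + s powr r) = G s) (nhds s)"
        using eventually_nhds_in_open[of "{0<..<1}" s] that
        by (auto elim!: eventually_mono simp: G_def \<Phi>S)
    qed auto
  qed
  \<comment> \<open>At a zero of \<open>g\<close> the second derivative of \<open>G\<close> will be
    K(s) (a \<rho>(s) - r) / s^2. As \<open>K\<close> is positive for s > 0, the sign is that of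
    \<open>a * \<rho> s - r\<close>.\<close>
  define K where "K s = a * s powr r / (1 + s powr r)\<^sup>2" for s
  define \<rho> where "\<rho> s = (s powr (1 - r) - s powr r) / (1 - s)" for s
  have dg: "((\<lambda>s. g s / s) has_real_derivative K s * (a * \<rho> s - r) / s\<^sup>2) (at s)"
    if s: "0 < s" "s < 1" and g0: "g s = 0" for s
  proof -
    have D: "((\<lambda>s. g s / s) has_real_derivative
        (((S2 s / s) * S0 s - S1 s * (S1 s / s)) / (S0 s * S0 s) - a * (r * s powr r / (1 + s powr r)\<^sup>2 / s)) * s / (s * s) - g s / (s * s)) (at s)"
      unfolding g_def using s S0p[OF s]
      by (auto intro!: derivative_eq_intros dS0 dS1 dv simp: field_simps)
    let ?w = "s powr r"
    have w: "?w > 0" using s by simp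
    \<comment> \<open>The critical point equation eliminates \<open>S1\<close>, the differential
      equation then eliminates \<open>S2\<close>, and \<open>S0\<close> cancels in the
      quotient.\<close>
    have S1: "S1 s = a * v s * S0 s" using g0 S0p[OF s] by (simp add: g_def field_simps)
    have S2: "(1 - s) * S2 s = s * (a\<^sup>2 * S0 s - 2 * a * S1 s)" using ode[OF s] by (simp add: algebra_simps)
    have S2': "S2 s = a\<^sup>2 * S0 s * s * (1 - 2 * v s) / (1 - s)"
    proof -
      have "(1 - s) * S2 s = a\<^sup>2 * S0 s * s * (1 - 2 * v s)" unfolding S2 S1 by (simp add: algebra_simps power2_eq_square)
      then show ?thesis using s by (simp add: field_simps)
    qed
    have quot: "((S2 s / s) * S0 s - S1 s * (S1 s / s)) / (S0 s * S0 s) = a\<^sup>2 * (s * (1 - 2 * v s) / (1 - s) - (v s)\<^sup>2) / s"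
      unfolding S2' S1 using S0p[OF s] s by (simp add: divide_simps) (simp add: algebra_simps power2_eq_square)
    have v1: "1 - 2 * v s = (1 - ?w\<^sup>2) / (1 + ?w)\<^sup>2" "(v s)\<^sup>2 = ?w\<^sup>2 / (1 + ?w)\<^sup>2"
      unfolding v_def using ppos[of s] by (simp_all add: divide_simps) (simp_all add: algebra_simps power2_eq_square)
    have \<rho>: "?w * \<rho> s = (s - ?w\<^sup>2) / (1 - s)"
    proof -
      have "?w * s powr (1 - r) = s" using s by (simp flip: powr_add)
      then show ?thesis by (simp add: \<rho>_def right_diff_distrib power2_eq_square)
    qed
    have "s * (1 - 2 * v s) / (1 - s) - (v s)\<^sup>2 = (s - ?w\<^sup>2) / (1 - s) / (1 + ?w)\<^sup>2"
      unfolding v1 using ppos[of s] s by (simp add: divide_simps) (simp add: algebra_simps)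
    also have "\<dots> = ?w * \<rho> s / (1 + ?w)\<^sup>2" by (simp only: \<rho>)
    finally have e: "s * (1 - 2 * v s) / (1 - s) - (v s)\<^sup>2 = ?w * \<rho> s / (1 + ?w)\<^sup>2" .
    show ?thesis
      by (rule DERIV_cong[OF D], unfold quot e g0 K_def)
         (use s ppos[of s] in \<open>simp add: divide_simps power2_eq_square, simp add: algebra_simps power2_eq_square\<close>)
  qed
  have Kpos: "K s > 0" if "0 < s" for s
    using that a ppos[of s] by (simp add: K_def)
  have G0: "G 0 = 0" using r by (simp add: G_def \<Phi>S S00)
  have G1: "G 1 \<le> 0"
  proof -
    have "ln (\<Phi> 1) \<le> ln (2 powr (a / r))" using one pos[of 1] by (subst ln_le_cancel_iff) auto
    then show ?thesis by (simp add: G_def ln_powr)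
  qed
  \<comment> \<open>Near 0 the logarithm of \<open>S0 h\<close> grows at most linearly, whereas the
    subtracted term is at least of order h^r, which dominates because \<open>r < 1\<close>.\<close>
  have Gneg: "\<exists>s. 0 < s \<and> s < b \<and> G s < 0" if b: "0 < b" "b < 1" for b
  proof -
    obtain D where D: "(S0 has_real_derivative D) (at 0)" using d0 by blast
    have "((\<lambda>h. (S0 (0 + h) - S0 0) / h) \<longlongrightarrow> D) (at 0)" using D by (simp add: DERIV_def)
    then have "((\<lambda>h. (S0 h - 1) / h) \<longlongrightarrow> D) (at_right 0)"
      by (simp add: S00 filterlim_at_split)
    then have 1: "eventually (\<lambda>h. (S0 h - 1) / h < D + 1) (at_right 0)"
      by (rule order_tendstoD) simp
    define m where "m = max 0 (D + 1)"
    define A where "A = a / r"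
    have A: "A > 0" using a r by (simp add: A_def)
    have "((\<lambda>h::real. (m / A) * (2 * h powr (1 - r))) \<longlongrightarrow> (m / A) * (2 * 0)) (at_right 0)"
      using r by (intro tendsto_intros tendsto_powr2[where b="1-r" and a=0, simplified]) (auto intro!: tendsto_eq_intros eventually_at_rightI[of 0 1])
    then have 2: "eventually (\<lambda>h::real. (m / A) * (2 * h powr (1 - r)) < 1) (at_right 0)"
      by (rule order_tendstoD) simp
    have 3: "eventually (\<lambda>h::real. h \<in> {0<..<b}) (at_right 0)"
      using b by (intro eventually_at_rightI[of 0 b]) auto
    have "eventually (\<lambda>h. 0 < h \<and> h < b \<and> G h < 0) (at_right 0)"
      using 1 2 3
    proof eventually_elim
      case (elim h)
      then have h: "0 < h" "h < 1" "h < b" using b by auto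
      have "S0 h - 1 < (D + 1) * h" using elim h by (simp add: field_simps)
      also have "\<dots> \<le> m * h" using h by (intro mult_right_mono) (auto simp: m_def)
      finally have S: "S0 h < 1 + m * h" by simp
      have w: "0 < h powr r" "h powr r \<le> 1" using h r by (auto simp: powr_le1)
      have "ln (S0 h) \<le> S0 h - 1" using S0p[of h] h by (intro ln_le_minus_one) auto
      also have "\<dots> < m * h" using S by simp
      also have "m * h = (m / A * (2 * h powr (1 - r))) * (A * (h powr r / 2))"
      proof -
        have "h powr (1 - r) * h powr r = h" using h by (simp flip: powr_add)
        then show ?thesis using A by (simp add: field_simps)
      qed
      also have "\<dots> \<le> 1 * (A * (h powr r / 2))"
        using elim(2) A w by (intro mult_right_mono) auto
      also have "\<dots> \<le> A * ln (1 + h powr r)"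
      proof -
        \<comment> \<open>Put w = h^r, which is at most 1. The bound ln x <= x - 1 at x = 1/(1 + w)
          gives (1 + w) ln(1 + w) >= w, and w ln(1 + w) <= ln(1 + w).\<close>
        have "h powr r / 2 \<le> ln (1 + h powr r)"
          using ln_le_minus_one[of "1 / (1 + h powr r)"] w
            mult_left_le_one_le[of "ln (1 + h powr r)" "h powr r"] by (simp add: ln_div field_simps)
        then show ?thesis using A by simp
      qed
      finally have "G h < 0" using h by (simp add: G_def \<Phi>S A_def)
      then show ?case using h by simp
    qed
    then show ?thesis
      using eventually_happens'[of "at_right (0::real)"] by (auto simp: trivial_limit_at_right_real)
  qed
  have "G s \<le> 0"
  proof (rule ccontr)
    assume "\<not> G s \<le> 0"
    obtain s0 where s0: "s0 \<in> {0..1}" "\<And>y. y \<in> {0..1} \<Longrightarrow> G y \<le> G s0"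
      using continuous_attains_sup[OF _ _ contG] by auto
    have Gs0: "G s0 > 0" using s0(2)[of s] s \<open>\<not> G s \<le> 0\<close> by simp
    have s01: "0 < s0" "s0 < 1"
      using s0(1) Gs0 G0 G1 by (cases "s0 = 0"; cases "s0 = 1"; auto)+
    have g0: "g s0 / s0 = 0"
      using s0(2) by (intro interior_max_deriv_zero[OF s01 dG[OF s01]]) auto
    have n0: "K s0 * (a * \<rho> s0 - r) / s0\<^sup>2 \<le> 0"
      using g0 s01 s0(2) by (intro interior_max_second_deriv_nonpos[OF s01 dG dg[OF s01]]) auto
    \<comment> \<open>The interval stops at \<open>s0\<close>, so that the minimum precedes the
      maximum. Its value is negative by \<open>Gneg\<close>, which keeps \<open>s1\<close> away from
      both ends.\<close>
    obtain s1 where s1: "s1 \<in> {0..s0}" "\<And>y. y \<in> {0..s0} \<Longrightarrow> G s1 \<le> G y"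
      using continuous_attains_inf[of "{0..s0}" G] continuous_on_subset[OF contG, of "{0..s0}"] s01
      by auto
    obtain z where z: "0 < z" "z < s0" "G z < 0" using Gneg[OF s01] by blast
    have "G s1 < 0" using s1(2)[of z] z by simp
    then have s11: "0 < s1" "s1 < s0" using s1(1) G0 Gs0 by (cases "s1 = 0"; cases "s1 = s0"; auto)+
    then have s1': "s1 < 1" using s01 by simp
    have g1: "- (g s1 / s1) = 0"
      using s1(2) by (intro interior_max_deriv_zero[OF s11 DERIV_minus[OF dG[OF s11(1) s1']]]) auto
    have n1: "- (K s1 * (a * \<rho> s1 - r) / s1\<^sup>2) \<le> 0"
      using g1 s11 s1' s1(2) s01
      by (intro interior_max_second_deriv_nonpos[OF s11, of "\<lambda>s. - G s" "\<lambda>s. - (g s / s)"]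
          DERIV_minus dG dg) auto
    have "\<rho> s1 < \<rho> s0" unfolding \<rho>_def using r s11 s01 by (intro powr_ratio_strict_mono) auto
    moreover have "a * \<rho> s0 \<le> r" using n0 s01 Kpos[of s0] by (simp add: divide_le_0_iff mult_le_0_iff)
    moreover have "r \<le> a * \<rho> s1" using n1 s11 Kpos[of s1] by (simp add: zero_le_divide_iff zero_le_mult_iff)
    ultimately have "a * \<rho> s0 < a * \<rho> s0" using a by (smt (verit) mult_strict_left_mono)
    then show False by simp
  qed
  then have "ln (\<Phi> s) \<le> a / r * ln (1 + s powr r)" by (simp add: G_def)
  then have "exp (ln (\<Phi> s)) \<le> exp (a / r * ln (1 + s powr r))" by simp
  then show ?thesis using pos[OF s] ppos[of s] by (simp add: powr_def)
qed

subsection \<open>Moments of trigonometric binomials\<close>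

abbreviation unit_interval :: "real measure" where
  "unit_interval \<equiv> restrict_space lborel {0..<1}"

interpretation unit_interval: prob_space unit_interval
  by (rule prob_spaceI) (simp add: emeasure_restrict_space)

lemma borel_measurable_unit_interval_continuous:
  fixes f :: "real \<Rightarrow> 'a::topological_space"
  assumes "continuous_on UNIV f"
  shows "f \<in> borel_measurable unit_interval"
  using borel_measurable_continuous_onI[OF assms] by (intro measurable_restrict_space1) simp

lemma integrable_unit_interval_continuous:
  fixes f :: "real \<Rightarrow> 'a::{banach, second_countable_topology}"
  assumes "continuous_on UNIV f"
  shows "integrable unit_interval f"
proof -
  have "compact (f ` {0..1})"
    using assms by (intro compact_continuous_image) (auto intro: continuous_on_subset)
  then obtain B where B: "\<And>x. x \<in> {0..1} \<Longrightarrow> norm (f x) \<le> B"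
    using compact_imp_bounded bounded_iff by (metis imageI)
  show ?thesis
    by (rule unit_interval.integrable_const_bound[of _ B])
       (use B borel_measurable_unit_interval_continuous[OF assms] in auto)
qed

text \<open>The point 1 is a null set. The closed interval suits the fundamental theorem of calculus
  and substitutions.\<close>

lemma unit_interval_lebesgue_eq:
  fixes f :: "real \<Rightarrow> 'a::{banach, second_countable_topology}"
  assumes "continuous_on UNIV f"
  shows "(LINT x|unit_interval. f x) = (LINT x|lborel. indicator {0..1} x *\<^sub>R f x)"
proof -
  have "(LINT x|unit_interval. f x) = (LINT x|lborel. indicator {0..<1} x *\<^sub>R f x)"
    by (subst integral_restrict_space) auto
  also have "\<dots> = (LINT x|lborel. indicator {0..1} x *\<^sub>R f x)"
  proof (rule integral_cong_AE)
    have "AE x in lborel. x \<noteq> (1::real)" by (rule AE_lborel_singleton)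
    then show "AE x in lborel. indicat_real {0..<1} x *\<^sub>R f x = indicat_real {0..1} x *\<^sub>R f x"
      by eventually_elim (auto simp: indicator_def)
  qed (use borel_measurable_continuous_onI[OF assms] in measurable)
  finally show ?thesis .
qed

lemma integral_cis_unit_interval:
  "(LINT \<xi>|unit_interval. cis (2 * pi * of_int k * \<xi>)) = (if k = 0 then 1 else 0)"
proof (cases "k = 0")
  case False
  have "(LINT \<xi>|unit_interval. cis (2 * pi * of_int k * \<xi>)) =
      (LINT x|lborel. indicator {0..1} x *\<^sub>R cis (2 * pi * of_int k * x))"
    by (rule unit_interval_lebesgue_eq) (auto intro!: continuous_intros)
  also have "\<dots> = cis (2 * pi * of_int k * 1) / (2 * pi * k * \<i>) - cis (2 * pi * of_int k * 0) / (2 * pi * k * \<i>)"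
  proof (rule integral_FTC_atLeastAtMost)
    fix x :: real
    show "((\<lambda>x. cis (2 * pi * of_int k * x) / (2 * pi * k * \<i>)) has_vector_derivative cis (2 * pi * of_int k * x)) (at x within {0..1})"
      unfolding cis_conv_exp using False
      by (auto intro!: derivative_eq_intros has_vector_derivative_real_field simp: field_simps)
  qed (auto intro!: continuous_intros)
  also have "cis (2 * pi * of_int k * 1) = 1"
    by (simp add: complex_eq_iff cos_int_2pin sin_int_2pin)
  finally show ?thesis using False by simp
qed (use unit_interval.prob_space in simp)

lemma parseval_finite:
  fixes c :: "nat \<Rightarrow> complex"
  shows "(LINT \<xi>|unit_interval. (norm (\<Sum>k<n. c k * cis (- (2 * pi * \<xi>)) ^ k))\<^sup>2) = (\<Sum>k<n. (norm (c k))\<^sup>2)"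
proof -
  have sq: "complex_of_real ((norm (\<Sum>k<n. c k * cis (- (2 * pi * \<xi>)) ^ k))\<^sup>2) =
      (\<Sum>j<n. \<Sum>k<n. (c j * cnj (c k)) * cis (2 * pi * of_int (int k - int j) * \<xi>))" for \<xi>
  proof -
    have cc: "cis (- (2 * pi * \<xi>)) ^ j * cnj (cis (- (2 * pi * \<xi>)) ^ k) = cis (2 * pi * of_int (int k - int j) * \<xi>)" for j k
    proof -
      have "cis (- (2 * pi * \<xi>)) ^ j * cnj (cis (- (2 * pi * \<xi>)) ^ k) =
          cis (real j * (- (2 * pi * \<xi>)) + - (real k * (- (2 * pi * \<xi>))))"
        unfolding Complex.DeMoivre cis_cnj cis_mult ..
      also have "real j * (- (2 * pi * \<xi>)) + - (real k * (- (2 * pi * \<xi>))) = 2 * pi * of_int (int k - int j) * \<xi>"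
        by (simp add: algebra_simps)
      finally show ?thesis .
    qed
    show ?thesis
      unfolding complex_norm_square cnj_sum sum_product
      by (intro sum.cong refl, simp only: complex_cnj_mult cc[symmetric]) (simp add: mult_ac)
  qed
  have "complex_of_real (LINT \<xi>|unit_interval. (norm (\<Sum>k<n. c k * cis (- (2 * pi * \<xi>)) ^ k))\<^sup>2) =
      (LINT \<xi>|unit_interval. (\<Sum>j<n. \<Sum>k<n. (c j * cnj (c k)) * cis (2 * pi * of_int (int k - int j) * \<xi>)))"
    unfolding integral_complex_of_real[symmetric] sq ..
  also have "\<dots> = (\<Sum>j<n. \<Sum>k<n. (c j * cnj (c k)) * (LINT \<xi>|unit_interval. cis (2 * pi * of_int (int k - int j) * \<xi>)))"
    by (subst Bochner_Integration.integral_sum, (intro integrable_unit_interval_continuous continuous_intros; simp))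
       (intro sum.cong refl, subst Bochner_Integration.integral_sum,
         (intro integrable_unit_interval_continuous continuous_intros; simp), simp)
  also have "\<dots> = (\<Sum>j<n. \<Sum>k<n. if k = j then (c j * cnj (c k)) else 0)"
    unfolding integral_cis_unit_interval by (intro sum.cong refl) auto
  also have "\<dots> = (\<Sum>k<n. c k * cnj (c k))" by simp
  also have "\<dots> = complex_of_real (\<Sum>k<n. (norm (c k))\<^sup>2)"
    by (simp only: of_real_sum complex_norm_square)
  finally show ?thesis by (simp only: of_real_eq_iff)
qed

text \<open>The partial sums are bounded by the sum of the norms of the coefficients, so dominated
  convergence carries the finite identity to the limit.\<close>

lemma parseval_summable:
  fixes c :: "nat \<Rightarrow> complex"
  assumes c: "summable (\<lambda>k. norm (c k))"
  shows "(\<lambda>k. (norm (c k))\<^sup>2) sums (LINT \<xi>|unit_interval. (norm (\<Sum>k. c k * cis (- (2 * pi * \<xi>)) ^ k))\<^sup>2)"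
proof -
  let ?S = "\<lambda>n \<xi>. \<Sum>k<n. c k * cis (- (2 * pi * \<xi>)) ^ k"
  let ?T = "\<lambda>\<xi>. \<Sum>k. c k * cis (- (2 * pi * \<xi>)) ^ k"
  define M where "M = (\<Sum>k. norm (c k))"
  have nk: "norm (c k * cis t ^ k) = norm (c k)" for k t by (simp add: norm_mult norm_power)
  have lim: "(\<lambda>n. ?S n \<xi>) \<longlonglongrightarrow> ?T \<xi>" for \<xi>
    by (rule summable_LIMSEQ, rule summable_norm_cancel) (use c in \<open>simp only: nk\<close>)
  have bd: "norm (?S n \<xi>) \<le> M" for n \<xi>
  proof -
    have "norm (?S n \<xi>) \<le> (\<Sum>k<n. norm (c k * cis (- (2 * pi * \<xi>)) ^ k))" by (rule norm_sum)
    also have "\<dots> = (\<Sum>k<n. norm (c k))" by (simp only: nk)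
    also have "\<dots> \<le> M" unfolding M_def by (rule sum_le_suminf[OF c]) auto
    finally show ?thesis .
  qed
  have "(\<lambda>n. LINT \<xi>|unit_interval. (norm (?S n \<xi>))\<^sup>2) \<longlonglongrightarrow> (LINT \<xi>|unit_interval. (norm (?T \<xi>))\<^sup>2)"
  proof (rule integral_dominated_convergence[where w = "\<lambda>_. M\<^sup>2"])
    have m: "?S n \<in> borel_measurable unit_interval" for n
      by (intro borel_measurable_unit_interval_continuous continuous_intros)
    show "(\<lambda>\<xi>. (norm (?S n \<xi>))\<^sup>2) \<in> borel_measurable unit_interval" for n
      using m[of n] by measurable
    have "?T \<in> borel_measurable unit_interval"
      by (rule borel_measurable_LIMSEQ_metric[OF m lim])
    then show "(\<lambda>\<xi>. (norm (?T \<xi>))\<^sup>2) \<in> borel_measurable unit_interval" by measurable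
    show "AE \<xi> in unit_interval. (\<lambda>n. (norm (?S n \<xi>))\<^sup>2) \<longlonglongrightarrow> (norm (?T \<xi>))\<^sup>2"
      by (intro AE_I2 tendsto_intros lim)
    show "AE \<xi> in unit_interval. norm ((norm (?S n \<xi>))\<^sup>2) \<le> M\<^sup>2" for n
      using bd by (auto intro!: power_mono)
  qed auto
  then show ?thesis unfolding parseval_finite sums_def .
qed

definition circle_moment :: "real \<Rightarrow> complex \<Rightarrow> real" where
  "circle_moment q z = (LINT \<xi>|unit_interval. norm (1 + z * cis (- (2 * pi * \<xi>))) powr q)"

text \<open>\<open>norm (1 + y) powr q\<close> is the squared modulus of (1 + y)^(q/2). For |y| < 1
  the latter is a binomial series, to which Parseval applies.\<close>

lemma circle_moment_series:
  assumes "norm z < 1"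
  shows "circle_moment q z = (\<Sum>k. ((q / 2) gchoose k)\<^sup>2 * ((norm z)\<^sup>2) ^ k)"
proof -
  define a where "a = q / 2"
  define c where "c k = complex_of_real (a gchoose k) * z ^ k" for k
  have nc: "norm (c k) = \<bar>a gchoose k\<bar> * \<bar>norm z\<bar> ^ k" for k by (simp add: c_def norm_mult norm_power)
  have sm: "summable (\<lambda>k. norm (c k))"
    unfolding nc using summable_abs_gbinomial_power[of "norm z" a] assms by simp
  have og: "(of_real a gchoose k :: complex) = of_real (a gchoose k)" for k
    by (simp add: gbinomial_prod_rev)
  have "(norm (\<Sum>k. c k * cis (- (2 * pi * \<xi>)) ^ k))\<^sup>2 = norm (1 + z * cis (- (2 * pi * \<xi>))) powr q" for \<xi>
  proof -
    let ?y = "z * cis (- (2 * pi * \<xi>))"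
    have "norm ?y < 1" using assms by (simp add: norm_mult)
    from gen_binomial_complex[OF this, of "of_real a"]
    have "(\<lambda>k. c k * cis (- (2 * pi * \<xi>)) ^ k) sums (1 + ?y) powr of_real a"
      by (simp add: og c_def power_mult_distrib mult_ac)
    then have "(\<Sum>k. c k * cis (- (2 * pi * \<xi>)) ^ k) = (1 + ?y) powr of_real a" by (rule sums_unique[symmetric])
    also have "(norm \<dots>)\<^sup>2 = (norm (1 + ?y) powr a)\<^sup>2" by (simp add: norm_powr_real_powr')
    also have "\<dots> = norm (1 + ?y) powr q" by (simp add: a_def power2_eq_square flip: powr_add)
    finally show ?thesis .
  qed
  with parseval_summable[OF sm] have "(\<lambda>k. (norm (c k))\<^sup>2) sums circle_moment q z"
    by (simp add: circle_moment_def)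
  then show ?thesis
    by (simp add: sums_iff nc a_def power_mult_distrib mult.commute flip: power_mult)
qed

text \<open>Continuity will carry statements from the open unit disc, where the series is available,
  to its boundary.\<close>

lemma isCont_circle_moment:
  assumes q: "q > 0"
  shows "isCont (circle_moment q) z"
  unfolding continuous_at_sequentially
proof (intro allI impI)
  fix u :: "nat \<Rightarrow> complex" assume u: "u \<longlonglongrightarrow> z"
  then have "bounded (range u)" by (rule convergent_imp_bounded)
  then obtain K where K: "\<And>n. norm (u n) \<le> K" by (auto simp: bounded_iff)
  let ?f = "\<lambda>z \<xi>. norm (1 + z * cis (- (2 * pi * \<xi>))) powr q"
  have m: "?f z \<in> borel_measurable unit_interval" for z
    using q by (intro borel_measurable_unit_interval_continuous continuous_on_powr' continuous_intros) auto
  have "(\<lambda>n. LINT \<xi>|unit_interval. ?f (u n) \<xi>) \<longlonglongrightarrow> (LINT \<xi>|unit_interval. ?f z \<xi>)"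
  proof (rule integral_dominated_convergence[where w = "\<lambda>_. (1 + K) powr q"])
    show "AE \<xi> in unit_interval. (\<lambda>n. ?f (u n) \<xi>) \<longlonglongrightarrow> ?f z \<xi>"
      using q by (intro AE_I2 tendsto_powr' tendsto_intros u) auto
    show "AE \<xi> in unit_interval. norm (?f (u n) \<xi>) \<le> (1 + K) powr q" for n
    proof (rule AE_I2)
      fix \<xi>
      have "norm (1 + u n * cis (- (2 * pi * \<xi>))) \<le> 1 + K"
        using norm_triangle_ineq[of 1 "u n * cis (- (2 * pi * \<xi>))"] K[of n] by (simp add: norm_mult)
      then show "norm (?f (u n) \<xi>) \<le> (1 + K) powr q" using q by (simp add: powr_mono2)
    qed
  qed (use m in auto)
  then show "(circle_moment q \<circ> u) \<longlonglongrightarrow> circle_moment q z"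
    by (simp add: circle_moment_def[abs_def] comp_def)
qed

lemma norm_one_plus_cis: "norm (1 + cis t) = 2 * \<bar>cos (t / 2)\<bar>"
proof -
  have "(norm (1 + cis t))\<^sup>2 = (1 + cos t)\<^sup>2 + (sin t)\<^sup>2" by (simp add: cmod_power2)
  also have "\<dots> = 2 + 2 * cos t"
    using sin_cos_squared_add[of t] by (simp add: power2_eq_square algebra_simps)
  also have "\<dots> = (2 * \<bar>cos (t / 2)\<bar>)\<^sup>2"
    using cos_double_cos[of "t / 2"] by (simp add: power_mult_distrib)
  finally have "(norm (1 + cis t))\<^sup>2 = (2 * \<bar>cos (t / 2)\<bar>)\<^sup>2" .
  then show ?thesis by (rule power2_eq_imp_eq) auto
qed

text \<open>This is the Beta integral under t = sin^2(pi x), a substitution that is increasing on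
  [0, 1/2], hence the half interval. Nonnegative integrals accommodate the singularity of the Beta
  integrand at t = 0.\<close>

lemma nn_integral_cos_powr_half:
  assumes q: "q > 0"
  shows "(\<integral>\<^sup>+x. ennreal (\<bar>cos (pi * x)\<bar> powr q) * indicator {0..1/2} x \<partial>lborel) =
     ennreal (Beta (1/2) ((q + 1) / 2) / (2 * pi))"
proof -
  define f where "f t = t powr (-1/2) * (1 - t) powr ((q - 1) / 2)" for t :: real
  have "(f has_integral Beta (1 / 2) ((q + 1) / 2)) {0..1}"
    using has_integral_Beta_real[of "1/2" "(q + 1) / 2"] q by (simp add: f_def[abs_def] diff_divide_distrib add_divide_distrib)
  from nn_integral_has_integral_lebesgue[OF _ this]
  have "ennreal (Beta (1 / 2) ((q + 1) / 2)) = (\<integral>\<^sup>+ t. ennreal (f t) * indicator {sin (pi * 0) ^ 2..sin (pi * (1/2)) ^ 2} t \<partial>lborel)"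
    by (simp add: f_def mult_ac ennreal_mult' ennreal_indicator)
  also have "\<dots> = (\<integral>\<^sup>+ t. ennreal (f t * indicator {sin (pi * 0) ^ 2..sin (pi * (1/2)) ^ 2} t) \<partial>lborel)"
    by (simp add: f_def mult_ac ennreal_mult' ennreal_indicator)
  also have "\<dots> = (\<integral>\<^sup>+ x. ennreal (f ((sin (pi * x))\<^sup>2) * (2 * pi * sin (pi * x) * cos (pi * x)) * indicator {0..1/2} x) \<partial>lborel)"
  proof (rule nn_integral_substitution)
    show "set_borel_measurable borel {(sin (pi * 0))\<^sup>2..(sin (pi * (1 / 2)))\<^sup>2} f"
      unfolding set_borel_measurable_def f_def by measurable
    show "((\<lambda>x. (sin (pi * x))\<^sup>2) has_real_derivative 2 * pi * sin (pi * x) * cos (pi * x)) (at x)" for x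
      by (auto intro!: derivative_eq_intros)
    show "continuous_on {0..1/2} (\<lambda>x. 2 * pi * sin (pi * x) * cos (pi * x))"
      by (intro continuous_intros)
    show "0 \<le> 2 * pi * sin (pi * x) * cos (pi * x)" if "x \<in> {0..1/2}" for x
      using that by (intro mult_nonneg_nonneg sin_ge_zero cos_ge_zero)
        (auto simp: field_simps intro: order_trans[of _ 0])
  qed auto
  also have "\<dots> = (\<integral>\<^sup>+ x. ennreal (2 * pi) * (ennreal (\<bar>cos (pi * x)\<bar> powr q) * indicator {0..1/2} x) \<partial>lborel)"
  proof (rule nn_integral_cong_AE)
    \<comment> \<open>At \<open>x = 0\<close> the integrands differ: the left one contains the
      factor sin 0 and vanishes, while the right one equals \<open>2 * pi\<close>.\<close>
    have "AE x in lborel. x \<noteq> (0::real)" "AE x in lborel. x \<noteq> (1/2::real)" by (rule AE_lborel_singleton)+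
    then show "AE x in lborel. ennreal (f ((sin (pi * x))\<^sup>2) * (2 * pi * sin (pi * x) * cos (pi * x)) * indicator {0..1/2} x) =
        ennreal (2 * pi) * (ennreal (\<bar>cos (pi * x)\<bar> powr q) * indicator {0..1/2} x)"
    proof eventually_elim
      case (elim x)
      show ?case
      proof (cases "x \<in> {0..1/2}")
        case True
        with elim have x: "0 < x" "x < 1/2" by auto
        have s: "sin (pi * x) > 0" using x by (intro sin_gt_zero) auto
        have c: "cos (pi * x) > 0" using x by (intro cos_gt_zero) auto
        have "f ((sin (pi * x))\<^sup>2) = 1 / sin (pi * x) * cos (pi * x) powr (q - 1)"
        proof -
          have "((sin (pi * x))\<^sup>2) powr (-1/2) = 1 / sin (pi * x)"
            using s by (simp add: powr_minus powr_half_sqrt field_simps)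
          moreover have "(1 - (sin (pi * x))\<^sup>2) = cos (pi * x) powr 2"
            using c by (simp add: cos_squared_eq)
          ultimately show ?thesis by (simp add: f_def powr_powr diff_divide_distrib)
        qed
        then have e: "f ((sin (pi * x))\<^sup>2) * (2 * pi * sin (pi * x) * cos (pi * x)) = 2 * pi * cos (pi * x) powr q"
          using s c by (simp add: powr_diff)
        show ?thesis unfolding e using True c by (simp add: ennreal_mult'[symmetric])
      qed auto
    qed
  qed
  also have "\<dots> = ennreal (2 * pi) * (\<integral>\<^sup>+ x. (ennreal (\<bar>cos (pi * x)\<bar> powr q) * indicator {0..1/2} x) \<partial>lborel)"
    by (rule nn_integral_cmult) measurable
  finally have e: "ennreal (Beta (1 / 2) ((q + 1) / 2)) = ennreal (2 * pi) * (\<integral>\<^sup>+ x. (ennreal (\<bar>cos (pi * x)\<bar> powr q) * indicator {0..1/2} x) \<partial>lborel)" .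
  have "ennreal (Beta (1/2) ((q + 1) / 2) / (2 * pi)) = ennreal (1 / (2 * pi)) * ennreal (Beta (1 / 2) ((q + 1) / 2))"
    by (simp flip: ennreal_mult')
  also have "\<dots> = ennreal (1 / (2 * pi)) * ennreal (2 * pi) * (\<integral>\<^sup>+ x. (ennreal (\<bar>cos (pi * x)\<bar> powr q) * indicator {0..1/2} x) \<partial>lborel)"
    unfolding e by (simp only: mult.assoc)
  also have "ennreal (1 / (2 * pi)) * ennreal (2 * pi) = 1" by (simp flip: ennreal_mult')
  finally show ?thesis by simp
qed

text \<open>The integrand is (2 |cos(pi x)|)^q. The reflection of x to 1 - x identifies the two
  halves of the interval, and Legendre's duplication formula turns the Beta value into the binomial
  coefficient.\<close>

lemma circle_moment_one:
  assumes q: "q > 0"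
  shows "circle_moment q 1 = gen_binomial q (q / 2)"
proof -
  let ?c = "\<lambda>x. \<bar>cos (pi * x)\<bar> powr q"
  let ?h = "Beta (1/2) ((q + 1) / 2) / (2 * pi)"
  have contc: "continuous_on UNIV ?c" using q by (intro continuous_on_powr' continuous_intros) auto
  have bpos: "?h \<ge> 0" using q unfolding Beta_def
    by (intro divide_nonneg_nonneg mult_nonneg_nonneg less_imp_le[OF Gamma_real_pos]) (auto intro!: add_pos_pos)
  have mc: "(\<lambda>x. ennreal (?c x)) \<in> borel_measurable borel"
    using borel_measurable_continuous_onI[OF contc] by measurable
  have refl: "(\<integral>\<^sup>+x. ennreal (?c x) * indicator {1/2..1} x \<partial>lborel) = (\<integral>\<^sup>+x. ennreal (?c x) * indicator {0..1/2} x \<partial>lborel)"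
  proof -
    have "(\<integral>\<^sup>+x. ennreal (?c x) * indicator {1/2..1} x \<partial>lborel) =
      ennreal \<bar>-1\<bar> * (\<integral>\<^sup>+x. ennreal (?c (1 + (-1) * x)) * indicator {1/2..1} (1 + (-1) * x) \<partial>lborel)"
      by (rule nn_integral_real_affine) (use mc in measurable)
    also have "\<dots> = (\<integral>\<^sup>+x. ennreal (?c x) * indicator {0..1/2} x \<partial>lborel)"
      by (auto intro!: nn_integral_cong simp: indicator_def right_diff_distrib cos_diff)
    finally show ?thesis .
  qed
  have "(\<integral>\<^sup>+x. ennreal (?c x) * indicator {0..1} x \<partial>lborel) =
     (\<integral>\<^sup>+x. (ennreal (?c x) * indicator {0..1/2} x + ennreal (?c x) * indicator {1/2..1} x) \<partial>lborel)"
  proof (rule nn_integral_cong_AE)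
    have "AE x in lborel. x \<noteq> (1/2::real)" by (rule AE_lborel_singleton)
    then show "AE x in lborel. ennreal (?c x) * indicator {0..1} x = ennreal (?c x) * indicator {0..1/2} x + ennreal (?c x) * indicator {1/2..1} x"
      by eventually_elim (auto simp: indicator_def)
  qed
  also have "\<dots> = ennreal ?h + ennreal ?h"
    by (subst nn_integral_add) (use mc in \<open>auto simp: refl nn_integral_cos_powr_half[OF q] intro!: borel_measurable_times\<close>)
  also have "\<dots> = ennreal (2 * ?h)" using bpos by (subst ennreal_plus[symmetric]) auto
  finally have nn: "(\<integral>\<^sup>+x. ennreal (indicator {0..1} x *\<^sub>R ?c x) \<partial>lborel) = ennreal (2 * ?h)"
    by (simp add: ennreal_mult' ennreal_indicator mult.commute)
  have "(LINT x|unit_interval. ?c x) = (LINT x|lborel. indicator {0..1} x *\<^sub>R ?c x)"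
    by (rule unit_interval_lebesgue_eq[OF contc])
  also have "\<dots> = 2 * ?h"
    by (subst integral_eq_nn_integral)
       (use nn bpos borel_measurable_continuous_onI[OF contc] in auto)
  finally have i: "(LINT x|unit_interval. ?c x) = Beta (1/2) ((q + 1) / 2) / pi" by simp
  have "norm (1 + 1 * cis (- (2 * pi * \<xi>))) powr q = 2 powr q * ?c \<xi>" for \<xi>
    by (simp add: norm_one_plus_cis powr_mult)
  then have "circle_moment q 1 = 2 powr q * (Beta (1/2) ((q + 1) / 2) / pi)"
    unfolding circle_moment_def by (simp add: i)
  also have "\<dots> = gen_binomial q (q / 2)"
  proof -
    let ?z = "(q + 1) / 2"
    have nz: "?z \<notin> \<int>\<^sub>\<le>\<^sub>0" "?z + 1/2 \<notin> \<int>\<^sub>\<le>\<^sub>0"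
      using q by (auto dest!: nonpos_Ints_nonpos simp: field_simps)
    \<comment> \<open>Duplication at (q + 1)/2 relates the Gamma values at (q + 1)/2, q/2 + 1 and q
      + 1. It is taken over the complex numbers and read back on the reals.\<close>
    have dup: "Gamma ?z * Gamma (?z + 1/2) = 2 powr (- q) * sqrt pi * Gamma (q + 1)"
    proof -
      have "complex_of_real ?z \<notin> \<int>\<^sub>\<le>\<^sub>0" "complex_of_real ?z + 1/2 \<notin> \<int>\<^sub>\<le>\<^sub>0"
        using nz of_real_in_nonpos_Ints_iff[of ?z, where 'a = complex]
          of_real_in_nonpos_Ints_iff[of "?z + 1/2", where 'a = complex] by simp_all
      note Gamma_legendre_duplication[OF this]
      moreover have "complex_of_real ?z + 1/2 = of_real (?z + 1/2)" "2 * complex_of_real ?z = of_real (q + 1)"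
        by simp_all
      moreover have "exp ((1 - 2 * complex_of_real ?z) * of_real (ln 2)) = of_real (exp (- q * ln 2))"
      proof -
        have "(1 - 2 * complex_of_real ?z) * of_real (ln 2) = of_real ((1 - 2 * ?z) * ln 2)" by simp
        also have "1 - 2 * ?z = - q" by (simp add: field_simps)
        finally show ?thesis by (simp only: exp_of_real)
      qed
      ultimately have "complex_of_real (Gamma ?z * Gamma (?z + 1/2)) =
          complex_of_real (exp (- q * ln 2) * sqrt pi * Gamma (q + 1))"
        by (simp only: Gamma_complex_of_real of_real_mult)
      then show ?thesis by (simp only: of_real_eq_iff powr_def) simp
    qed
    have g: "Gamma (q / 2 + 1) > 0" using q by (intro Gamma_real_pos) auto
    have e: "?z + 1/2 = q / 2 + 1" "1/2 + ?z = q / 2 + 1" by (simp_all add: field_simps)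
    have G: "Gamma ?z = 2 powr (- q) * sqrt pi * Gamma (q + 1) / Gamma (q / 2 + 1)"
      using dup g unfolding e by (simp add: field_simps)
    show ?thesis
      unfolding gen_binomial_def Beta_def e G Gamma_one_half_real using g
      by (simp add: powr_minus field_simps)
  qed
  finally show ?thesis .
qed

subsection \<open>The two-point inequality\<close>

text \<open>By its series the moment depends on |z| alone, so this is
  \<open>hypergeometric_le_powr\<close> with a = q/2, r = p/2 and s = |z|^2. The hypothesis
  \<open>B\<close> is the bound required at s = 1.\<close>

lemma circle_moment_le_strict:
  assumes q: "0 < q" and p: "1 < p" "p < 2" and B: "gen_binomial q (q / 2) \<le> 2 powr (q / p)"
    and z: "norm z < 1"
  shows "circle_moment q z \<le> (1 + norm z powr p) powr (q / p)"
proof -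
  define \<Phi> where "\<Phi> s = circle_moment q (of_real (sqrt s))" for s
  have "continuous_on UNIV (circle_moment q)"
    by (simp add: continuous_at_imp_continuous_on isCont_circle_moment[OF q])
  then have cont: "continuous_on {0..1} \<Phi>"
    unfolding \<Phi>_def by (rule continuous_on_compose2) (auto intro!: continuous_intros)
  have ser: "\<Phi> s = (\<Sum>k. (q / 2 gchoose k)\<^sup>2 * s ^ k)" if "0 \<le> s" "s < 1" for s
    unfolding \<Phi>_def using that by (subst circle_moment_series) auto
  have "\<Phi> ((norm z)\<^sup>2) \<le> (1 + ((norm z)\<^sup>2) powr (p / 2)) powr ((q / 2) / (p / 2))"
  proof (rule hypergeometric_le_powr[OF _ _ _ ser cont])
    show "\<Phi> 1 \<le> 2 powr ((q / 2) / (p / 2))" using B by (simp add: \<Phi>_def circle_moment_one[OF q])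
    show "(norm z)\<^sup>2 \<le> 1" using z by (simp add: power_le_one)
  qed (use p q in auto)
  also have "((norm z)\<^sup>2) powr (p / 2) = norm z powr p"
    by (cases "z = 0") (simp_all add: powr_powr flip: powr_numeral)
  also have "\<Phi> ((norm z)\<^sup>2) = circle_moment q z"
    unfolding \<Phi>_def using z by (simp add: circle_moment_series)
  finally show ?thesis by simp
qed

text \<open>Two limits extend the strict case. For \<open>p = 2\<close> the exponent is approached
  by t < 2, to which \<open>B\<close> passes because q/t >= q/2. For |z| = 1 the point is approached
  by its contractions \<open>u n\<close>.\<close>

lemma circle_moment_le:
  assumes q: "0 < q" and p: "1 < p" "p \<le> 2" and B: "gen_binomial q (q / 2) \<le> 2 powr (q / p)"
    and z: "norm z \<le> 1"
  shows "circle_moment q z \<le> (1 + norm z powr p) powr (q / p)"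
proof -
  have strict: "circle_moment q z \<le> (1 + norm z powr p) powr (q / p)" if z: "norm z < 1" for z
  proof (cases "p = 2")
    case False
    then show ?thesis using circle_moment_le_strict[OF q _ _ B z] p by simp
  next
    case True
    show ?thesis
    proof (rule tendsto_lowerbound)
      show "((\<lambda>p. (1 + norm z powr p) powr (q / p)) \<longlongrightarrow> (1 + norm z powr p) powr (q / p)) (at_left p)"
      proof (cases "z = 0")
        case False
        have "1 + norm z powr p \<noteq> 0" by (smt (verit) powr_ge_zero)
        then show ?thesis using p False by (intro tendsto_powr tendsto_divide tendsto_add tendsto_const tendsto_ident_at) auto
      qed simp
      have "eventually (\<lambda>t. t \<in> {1<..<2}) (at_left p)"
        unfolding True by (rule eventually_at_leftI[of 1]) auto
      then show "eventually (\<lambda>p. circle_moment q z \<le> (1 + norm z powr p) powr (q / p)) (at_left p)"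
      proof eventually_elim
        case (elim t)
        have "gen_binomial q (q / 2) \<le> 2 powr (q / t)"
          using B elim q True by (elim order_trans) (auto intro!: powr_mono simp: field_simps)
        then show ?case using circle_moment_le_strict[OF q _ _ _ z, of t] elim by simp
      qed
    qed simp
  qed
  define u where "u n = of_real (1 - inverse (real (Suc n))) * z" for n
  have u: "u \<longlonglongrightarrow> z"
    unfolding u_def by (rule tendsto_eq_intros LIMSEQ_inverse_real_of_nat refl | simp)+
  have nu: "norm (u n) < 1" for n
  proof -
    have "norm (u n) = \<bar>1 - inverse (real (Suc n))\<bar> * norm z" by (simp only: u_def norm_mult norm_of_real)
    also have "\<dots> \<le> \<bar>1 - inverse (real (Suc n))\<bar> * 1" using z by (intro mult_left_mono) auto
    also have "\<dots> < 1" by (auto simp: field_simps)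
    finally show ?thesis .
  qed
  show ?thesis
  proof (rule LIMSEQ_le)
    show "(\<lambda>n. circle_moment q (u n)) \<longlonglongrightarrow> circle_moment q z"
      by (rule isCont_tendsto_compose[OF isCont_circle_moment[OF q] u])
    show "(\<lambda>n. (1 + norm (u n) powr p) powr (q / p)) \<longlonglongrightarrow> (1 + norm z powr p) powr (q / p)"
    proof -
      have l: "(\<lambda>n. norm (u n) powr p) \<longlonglongrightarrow> norm z powr p"
        using p by (intro tendsto_powr' tendsto_intros u) auto
      have "1 + norm z powr p \<noteq> 0" by (smt (verit) powr_ge_zero)
      then show ?thesis by (intro tendsto_powr tendsto_add tendsto_const l)
    qed
    show "\<exists>N. \<forall>n\<ge>N. circle_moment q (u n) \<le> (1 + norm (u n) powr p) powr (q / p)"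
      using strict[OF nu] by blast
  qed
qed

text \<open>By homogeneity the larger coefficient can be factored out. If this is \<open>b\<close>,
  conjugation and multiplication by a unimodular factor first exchange the roles of the
  coefficients.\<close>

lemma two_point_inequality:
  assumes q: "0 < q" and p: "1 < p" "p \<le> 2" and B: "gen_binomial q (q / 2) \<le> 2 powr (q / p)"
  shows "(LINT \<xi>|unit_interval. norm (a + b * cis (- (2 * pi * \<xi>))) powr q) \<le> (norm a powr p + norm b powr p) powr (q / p)"
proof -
  have main: "(LINT \<xi>|unit_interval. norm (a + b * cis (- (2 * pi * \<xi>))) powr q) \<le> (norm a powr p + norm b powr p) powr (q / p)"
    if ab: "norm b \<le> norm a" for a b
  proof (cases "a = 0")
    case True
    then show ?thesis using ab q by simp
  next
    case False
    have "norm (a + b * cis (- (2 * pi * \<xi>))) powr q = norm a powr q * norm (1 + (b / a) * cis (- (2 * pi * \<xi>))) powr q" for \<xi>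
    proof -
      have "a + b * cis (- (2 * pi * \<xi>)) = a * (1 + (b / a) * cis (- (2 * pi * \<xi>)))" using False by (simp add: field_simps)
      then show ?thesis by (simp only: norm_mult powr_mult norm_ge_zero)
    qed
    then have "(LINT \<xi>|unit_interval. norm (a + b * cis (- (2 * pi * \<xi>))) powr q) = norm a powr q * circle_moment q (b / a)"
      by (simp add: circle_moment_def)
    also have "\<dots> \<le> norm a powr q * (1 + norm (b / a) powr p) powr (q / p)"
      using ab False by (intro mult_left_mono circle_moment_le[OF q p B]) (auto simp: norm_divide)
    also have "\<dots> = (norm a powr p * (1 + norm (b / a) powr p)) powr (q / p)"
      using p by (simp add: powr_mult powr_powr)
    also have "norm a powr p * (1 + norm (b / a) powr p) = norm a powr p + norm b powr p"
      using False by (simp add: norm_divide powr_divide field_simps)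
    finally show ?thesis .
  qed
  show ?thesis
  proof (cases "norm b \<le> norm a")
    case True
    then show ?thesis by (rule main)
  next
    case False
    have "norm (a + b * cis (- (2 * pi * \<xi>))) = norm (cnj b + cnj a * cis (- (2 * pi * \<xi>)))" for \<xi>
    proof -
      have "cnj (a + b * cis (- (2 * pi * \<xi>))) = cis (2 * pi * \<xi>) * (cnj b + cnj a * cis (- (2 * pi * \<xi>)))"
        by (simp add: cis_cnj distrib_left cis_mult mult.left_commute)
      then have "norm (cnj (a + b * cis (- (2 * pi * \<xi>)))) = norm (cnj b + cnj a * cis (- (2 * pi * \<xi>)))"
        by (simp only: norm_mult norm_cis mult_1)
      then show ?thesis by (simp only: complex_mod_cnj)
    qed
    then show ?thesis using main[of "cnj a" "cnj b"] False by (simp add: add.commute)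
  qed
qed

subsection \<open>Integral inequalities and functions on the torus\<close>

text \<open>If one of the points is 0, the claim comes down to c^m <= c for the weight c of the
  other point. Otherwise it is convexity on the positive half-line.\<close>

lemma powr_convex_nonneg:
  fixes x y \<kappa> m :: real
  assumes m: "1 \<le> m" and xy: "0 \<le> x" "0 \<le> y" and l: "0 < \<kappa>" "\<kappa> < 1"
  shows "(\<kappa> * x + (1 - \<kappa>) * y) powr m \<le> \<kappa> * x powr m + (1 - \<kappa>) * y powr m"
proof -
  have le: "c powr m \<le> c" if "0 < c" "c < 1" for c :: real
    using that m powr_mono'[of 1 m c] by simp
  consider "x = 0" | "y = 0" | "x > 0" "y > 0" using xy by linarith
  then show ?thesis
  proof cases
    case 1
    then show ?thesis using le[of "1 - \<kappa>"] l xy m by (auto simp: powr_mult intro!: mult_right_mono)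
  next
    case 2
    then show ?thesis using le[of \<kappa>] l xy m by (auto simp: powr_mult intro!: mult_right_mono)
  next
    case 3
    then show ?thesis using convex_onD[OF powr_convex[OF m], of "1 - \<kappa>" x y] l by simp
  qed
qed

text \<open>u + v is s + t times the average of u/s and v/t with weights s/(s + t) and t/(s + t), to
  which convexity applies. Integrating with \<open>s\<close> and \<open>t\<close> as norm bounds
  yields Minkowski's inequality.\<close>

lemma powr_add_weighted:
  fixes u v s t m :: real
  assumes m: "1 \<le> m" and "0 \<le> u" "0 \<le> v" and st: "0 < s" "0 < t"
  shows "(u + v) powr m \<le> (s + t) powr m * (s / (s + t) * (u powr m / s powr m) + t / (s + t) * (v powr m / t powr m))"
proof -
  have "u + v = (s + t) * (s / (s + t) * (u / s) + (1 - s / (s + t)) * (v / t))"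
  proof -
    have "1 - s / (s + t) = t / (s + t)" using st by (simp add: field_simps)
    then show ?thesis using st by (simp add: distrib_left)
  qed
  then have "(u + v) powr m = (s + t) powr m * (s / (s + t) * (u / s) + (1 - s / (s + t)) * (v / t)) powr m"
    using assms by (simp add: powr_mult)
  also have "\<dots> \<le> (s + t) powr m * (s / (s + t) * (u / s) powr m + (1 - s / (s + t)) * (v / t) powr m)"
    using assms by (intro mult_left_mono powr_convex_nonneg) auto
  also have "1 - s / (s + t) = t / (s + t)" using st by (simp add: field_simps)
  finally show ?thesis using assms by (simp add: powr_divide)
qed

lemma integrable_powr_add:
  fixes U V :: "'a \<Rightarrow> real"
  assumes m: "1 \<le> m"
    and [measurable]: "U \<in> borel_measurable M" "V \<in> borel_measurable M"
    and nn: "\<And>x. 0 \<le> U x" "\<And>x. 0 \<le> V x"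
    and i: "integrable M (\<lambda>x. U x powr m)" "integrable M (\<lambda>x. V x powr m)"
  shows "integrable M (\<lambda>x. (U x + V x) powr m)"
proof (rule Bochner_Integration.integrable_bound)
  show "integrable M (\<lambda>x. (1 + 1) powr m * (1 / (1 + 1) * (U x powr m / 1 powr m) + 1 / (1 + 1) * (V x powr m / 1 powr m)))"
    using i by simp
  show "AE x in M. norm ((U x + V x) powr m) \<le>
      norm ((1 + 1) powr m * (1 / (1 + 1) * (U x powr m / 1 powr m) + 1 / (1 + 1) * (V x powr m / 1 powr m)))"
    using powr_add_weighted[OF m nn, of 1 1] by (intro AE_I2) (smt (verit) norm_powr_real_powr powr_ge_zero real_norm_def zero_less_one)
qed measurable

text \<open>Positive upper bounds \<open>s\<close> and \<open>t\<close> stand in for the norms, so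
  that functions of norm 0 need no separate case.\<close>

lemma Minkowski_integral:
  fixes U V :: "'a \<Rightarrow> real"
  assumes m: "1 \<le> m"
    and meas: "U \<in> borel_measurable M" "V \<in> borel_measurable M"
    and nn: "\<And>x. 0 \<le> U x" "\<And>x. 0 \<le> V x"
    and i: "integrable M (\<lambda>x. U x powr m)" "integrable M (\<lambda>x. V x powr m)"
    and st: "0 < s" "0 < t"
    and U: "(LINT x|M. U x powr m) \<le> s powr m" and V: "(LINT x|M. V x powr m) \<le> t powr m"
  shows "(LINT x|M. (U x + V x) powr m) \<le> (s + t) powr m"
proof -
  have "(LINT x|M. (U x + V x) powr m) \<le>
     (LINT x|M. (s + t) powr m * (s / (s + t) * (U x powr m / s powr m) + t / (s + t) * (V x powr m / t powr m)))"
    using i powr_add_weighted[OF m nn st] by (intro integral_mono integrable_powr_add assms) auto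
  also have "\<dots> = (s + t) powr m * (s / (s + t) * ((LINT x|M. U x powr m) / s powr m) + t / (s + t) * ((LINT x|M. V x powr m) / t powr m))"
    using i by simp
  also have "\<dots> \<le> (s + t) powr m * (s / (s + t) * 1 + t / (s + t) * 1)"
    using U V st by (intro mult_left_mono add_mono) auto
  also have "s / (s + t) * 1 + t / (s + t) * 1 = 1" using st by (simp add: add_divide_distrib[symmetric])
  finally show ?thesis by simp
qed

text \<open>Young's inequality is integrated for U/s and V/t. As in
  \<open>Minkowski_integral\<close>, positive upper bounds stand in for the norms.\<close>

lemma Hoelder_integral:
  fixes U V :: "'a \<Rightarrow> real"
  assumes ab: "1 < a" "1 < b" "1 / a + 1 / b = 1"
    and [measurable]: "U \<in> borel_measurable M" "V \<in> borel_measurable M"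
    and nn: "\<And>x. 0 \<le> U x" "\<And>x. 0 \<le> V x"
    and i: "integrable M (\<lambda>x. U x powr a)" "integrable M (\<lambda>x. V x powr b)"
    and st: "0 < s" "0 < t"
    and U: "(LINT x|M. U x powr a) \<le> s powr a" and V: "(LINT x|M. V x powr b) \<le> t powr b"
  shows "integrable M (\<lambda>x. U x * V x)" and "(LINT x|M. U x * V x) \<le> s * t"
proof -
  have Y: "U x * V x \<le> s * t * (U x powr a / s powr a / a + V x powr b / t powr b / b)" for x
  proof -
    have "U x / s * (V x / t) \<le> (U x / s) powr a / a + (V x / t) powr b / b"
      using nn st by (intro Youngs_inequality ab) auto
    then have "s * t * (U x / s * (V x / t)) \<le> s * t * ((U x / s) powr a / a + (V x / t) powr b / b)"
      using st by (intro mult_left_mono) auto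
    then show ?thesis using st nn by (simp add: powr_divide)
  qed
  have I: "integrable M (\<lambda>x. s * t * (U x powr a / s powr a / a + V x powr b / t powr b / b))"
    using i by simp
  show J: "integrable M (\<lambda>x. U x * V x)"
  proof (rule Bochner_Integration.integrable_bound[OF I])
    have "norm (U x * V x) = U x * V x" for x using nn[of x] by simp
    then show "AE x in M. norm (U x * V x) \<le> norm (s * t * (U x powr a / s powr a / a + V x powr b / t powr b / b))"
      using Y by (intro AE_I2) (simp only: real_norm_def order_trans[OF _ abs_ge_self])
  qed measurable
  have "(LINT x|M. U x * V x) \<le> (LINT x|M. s * t * (U x powr a / s powr a / a + V x powr b / t powr b / b))"
    by (rule integral_mono[OF J I Y])
  also have "\<dots> = s * t * ((LINT x|M. U x powr a) / s powr a / a + (LINT x|M. V x powr b) / t powr b / b)"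
    using i by simp
  also have "\<dots> \<le> s * t * (1 / a + 1 / b)"
    using U V st ab by (intro mult_left_mono add_mono divide_right_mono) auto
  finally show "(LINT x|M. U x * V x) \<le> s * t" using ab by simp
qed

text \<open>Hoelder's inequality is applied to \<open>U x powr r\<close> and the constant 1, with
  exponent s/r. The constant has norm 1 on a probability space.\<close>

lemma (in prob_space) powr_mean_mono:
  fixes U :: "'a \<Rightarrow> real"
  assumes rs: "0 < r" "r \<le> s"
    and [measurable]: "U \<in> borel_measurable M" and nn: "\<And>x. 0 \<le> U x"
    and i: "integrable M (\<lambda>x. U x powr s)"
  shows "integrable M (\<lambda>x. U x powr r)" and "(LINT x|M. U x powr r) powr (1 / r) \<le> (LINT x|M. U x powr s) powr (1 / s)"
proof -
  show J: "integrable M (\<lambda>x. U x powr r)"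
  proof (rule Bochner_Integration.integrable_bound)
    show "integrable M (\<lambda>x. 1 + U x powr s)" using i by simp
    show "AE x in M. norm (U x powr r) \<le> norm (1 + U x powr s)"
    proof (rule AE_I2)
      fix x
      have "U x powr r \<le> 1 + U x powr s"
      proof (cases "U x \<le> 1")
        case True
        then have "U x powr r \<le> 1" using nn[of x] rs by (simp add: powr_le1)
        then show ?thesis by (simp add: add_increasing2)
      next
        case False
        then have "U x powr r \<le> U x powr s" using rs by (intro powr_mono) auto
        then show ?thesis by simp
      qed
      then show "norm (U x powr r) \<le> norm (1 + U x powr s)" by simp
    qed
  qed measurable
  show "(LINT x|M. U x powr r) powr (1 / r) \<le> (LINT x|M. U x powr s) powr (1 / s)"
  proof (cases "r = s")
    case False
    define a where "a = s / r"
    define b where "b = s / (s - r)"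
    have ab: "1 < a" "1 < b" "1 / a + 1 / b = 1" using rs False by (auto simp: a_def b_def field_simps)
    have sa: "(U x powr r) powr a = U x powr s" for x using rs by (simp add: powr_powr a_def)
    have I0: "0 \<le> (LINT x|M. U x powr s)" by simp
    \<comment> \<open>The norm may be 0, while Hoelder's inequality is stated with positive bounds.
      Every strictly larger \<open>e\<close> is therefore treated first.\<close>
    have *: "(LINT x|M. U x powr r) \<le> e" if e: "(LINT x|M. U x powr s) powr (r / s) < e" for e
    proof -
      have "(LINT x|M. U x powr s) powr (r / s) \<ge> 0" by simp
      then have "e > 0" using e by linarith
      have "(LINT x|M. U x powr s) = ((LINT x|M. U x powr s) powr (r / s)) powr a"
        using rs I0 by (simp add: powr_powr a_def)
      also have "\<dots> \<le> e powr a" using e ab by (intro powr_mono2) auto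
      finally have "(LINT x|M. U x powr s) \<le> e powr a" .
      then have "(LINT x|M. U x powr r * 1) \<le> e * 1"
        using i \<open>e > 0\<close> prob_space by (intro Hoelder_integral(2)[OF ab]) (auto simp: sa)
      then show ?thesis by simp
    qed
    then have "(LINT x|M. U x powr r) \<le> (LINT x|M. U x powr s) powr (r / s)" by (rule dense_ge)
    then have "(LINT x|M. U x powr r) powr (1 / r) \<le> ((LINT x|M. U x powr s) powr (r / s)) powr (1 / r)"
      using rs by (intro powr_mono2) auto
    also have "\<dots> = (LINT x|M. U x powr s) powr (1 / s)" using rs by (simp add: powr_powr)
    finally show ?thesis .
  qed simp
qed

lemma (in prob_space) Lp_space_mono:
  assumes r: "0 < r" "ennreal r \<le> s" and g: "g \<in> Lp_space M s"
  shows "g \<in> Lp_space M (ennreal r)" and "Lp_norm M (ennreal r) g \<le> Lp_norm M s g"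
proof -
  have [measurable]: "g \<in> borel_measurable M" using g by (auto simp: Lp_space_def)
  have "g \<in> Lp_space M (ennreal r) \<and> Lp_norm M (ennreal r) g \<le> Lp_norm M s g"
  proof (cases "s = \<top>")
    case True
    define K where "K = enn2real (esssup M (\<lambda>x. ennreal (norm (g x))))"
    have "esssup M (\<lambda>x. ennreal (norm (g x))) < \<top>" using g True by (simp add: Lp_space_def)
    then have K: "esssup M (\<lambda>x. ennreal (norm (g x))) = ennreal K" "0 \<le> K" by (auto simp: K_def)
    have ae: "AE x in M. norm (g x) powr r \<le> K powr r"
      using esssup_AE[of "\<lambda>x. ennreal (norm (g x))" M] unfolding K(1)
      by eventually_elim (use r K in \<open>auto intro!: powr_mono2 simp: ennreal_le_iff\<close>)
    have int: "integrable M (\<lambda>x. norm (g x) powr r)"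
      by (rule integrable_const_bound[of _ "K powr r"]) (use ae in auto)
    have "(LINT x|M. norm (g x) powr r) \<le> (LINT x|M. K powr r)"
      using int ae by (intro integral_mono_AE) auto
    also have "\<dots> = K powr r" by (simp add: prob_space)
    finally have "(LINT x|M. norm (g x) powr r) powr (1 / r) \<le> (K powr r) powr (1 / r)"
      using r by (intro powr_mono2) auto
    also have "\<dots> = K" using r K by (simp add: powr_powr)
    finally show ?thesis using int r True by (simp add: Lp_space_def Lp_norm_def K_def)
  next
    case False
    define t where "t = enn2real s"
    have s: "s = ennreal t" using False by (auto simp: t_def less_top)
    have t: "r \<le> t" using r by (auto simp: s ennreal_le_iff2)
    have "integrable M (\<lambda>x. norm (g x) powr t)" using g t r by (simp add: Lp_space_def s)
    from powr_mean_mono[OF r(1) t _ _ this] show ?thesis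
      using r t by (simp add: Lp_space_def Lp_norm_def s)
  qed
  then show "g \<in> Lp_space M (ennreal r)" and "Lp_norm M (ennreal r) g \<le> Lp_norm M s g" by auto
qed

section \<open>The torus, its characters and polynomials with frequencies in the cube\<close>

interpretation unit_intervals: product_sigma_finite "\<lambda>_::nat. unit_interval"
  by unfold_locales

lemma prob_space_torus: "prob_space (torus d)"
  unfolding torus_def by (rule prob_space_PiM) unfold_locales

lemma measurable_torus_component:
  assumes "i < d" "f \<in> borel_measurable unit_interval"
  shows "(\<lambda>\<xi>. f (\<xi> i)) \<in> borel_measurable (torus d)"
  using assms unfolding torus_def by (intro measurable_compose[OF measurable_component_singleton]) auto

lemma torus_Suc: "torus (Suc d) = Pi\<^sub>M (insert d {..<d}) (\<lambda>_. unit_interval)"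
  by (simp add: torus_def lessThan_Suc)

lemma integral_torus_Suc:
  fixes f :: "_ \<Rightarrow> 'b::{banach, second_countable_topology}"
  assumes "integrable (torus (Suc d)) f"
  shows "integral\<^sup>L (torus (Suc d)) f = (LINT \<xi>|torus d. LINT y|unit_interval. f (\<xi>(d := y)))"
  using unit_intervals.product_integral_insert[of "{..<d}" d f] assms
  unfolding torus_Suc by (simp add: torus_def)

lemma integral_torus_prod:
  fixes f :: "nat \<Rightarrow> real \<Rightarrow> 'b::{real_normed_field, banach, second_countable_topology}"
  assumes "\<And>i. i < d \<Longrightarrow> integrable unit_interval (f i)"
  shows "(LINT \<xi>|torus d. (\<Prod>i<d. f i (\<xi> i))) = (\<Prod>i<d. integral\<^sup>L unit_interval (f i))"
  unfolding torus_def using assms by (intro unit_intervals.product_integral_prod) auto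

lemma finite_cube: "finite (cube d)"
  unfolding cube_def by (intro finite_PiE) auto

lemma sum_cube_Suc:
  fixes h :: "(nat \<Rightarrow> int) \<Rightarrow> 'b::comm_monoid_add"
  shows "sum h (cube (Suc d)) = (\<Sum>x\<in>cube d. h (x(d := 0)) + h (x(d := 1)))"
proof -
  have inj: "inj_on (\<lambda>(y, g). g(d := y)) ({0, 1::int} \<times> cube d)"
    using inj_combinator[of d "{..<d}" "\<lambda>_. {0, 1::int}"] by (simp add: cube_def)
  have "cube (Suc d) = (\<lambda>(y, g). g(d := y)) ` ({0, 1} \<times> cube d)"
    using PiE_insert_eq[of d "{..<d}" "\<lambda>_. {0, 1::int}"] by (simp add: cube_def lessThan_Suc)
  then have "sum h (cube (Suc d)) = (\<Sum>(y, g)\<in>{0, 1} \<times> cube d. h (g(d := y)))"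
    using sum.reindex[OF inj, of h] by (simp add: comp_def case_prod_unfold)
  also have "\<dots> = (\<Sum>y\<in>{0, 1}. \<Sum>g\<in>cube d. h (g(d := y)))" by (rule sum.cartesian_product[symmetric])
  also have "\<dots> = (\<Sum>x\<in>cube d. h (x(d := 0)) + h (x(d := 1)))" by (simp add: sum.distrib)
  finally show ?thesis .
qed

text \<open>The exponential of \<open>fourier_coeff\<close>, factored over the coordinates so that
  one coordinate can be split off at a time.\<close>

definition torus_char :: "nat \<Rightarrow> (nat \<Rightarrow> int) \<Rightarrow> (nat \<Rightarrow> real) \<Rightarrow> complex" where
  "torus_char d x \<xi> = (\<Prod>i<d. cis (- (2 * pi * (of_int (x i) * \<xi> i))))"

lemma fourier_coeff_char: "fourier_coeff d g x = (LINT \<xi>|torus d. g \<xi> * torus_char d x \<xi>)"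
proof -
  have "torus_char d x \<xi> = exp (- 2 * of_real pi * \<i> * of_real (\<Sum>i<d. of_int (x i) * \<xi> i))" for \<xi>
    by (simp add: torus_char_def cis_conv_exp sum_distrib_left exp_sum mult_ac sum_negf[symmetric])
  then show ?thesis by (simp add: fourier_coeff_def)
qed

lemma norm_torus_char: "norm (torus_char d x \<xi>) = 1"
  by (simp add: torus_char_def prod_norm[symmetric])

lemma measurable_torus_char: "torus_char d x \<in> borel_measurable (torus d)"
  unfolding torus_char_def
  by (intro borel_measurable_prod measurable_torus_component[where f = "\<lambda>y. cis (- (2 * pi * (of_int (x _) * y)))"]
      borel_measurable_unit_interval_continuous) (auto intro!: continuous_intros)

lemma torus_char_Suc:
  "torus_char (Suc d) (x(d := b)) (\<xi>(d := y)) = torus_char d x \<xi> * cis (- (2 * pi * (of_int b * y)))"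
  by (simp add: torus_char_def)

text \<open>The transpose of restricting the Fourier transform to the cube: integrating
  \<open>g\<close> against it gives the sum of \<open>f x * fourier_coeff d g x\<close>. The pairing
  has no conjugation.\<close>

definition cube_poly :: "nat \<Rightarrow> ((nat \<Rightarrow> int) \<Rightarrow> complex) \<Rightarrow> (nat \<Rightarrow> real) \<Rightarrow> complex" where
  "cube_poly d f \<xi> = (\<Sum>x\<in>cube d. f x * torus_char d x \<xi>)"

lemma measurable_cube_poly [measurable]: "cube_poly d f \<in> borel_measurable (torus d)"
  unfolding cube_poly_def by (intro borel_measurable_sum borel_measurable_times measurable_torus_char) auto

lemma norm_cube_poly_le: "norm (cube_poly d f \<xi>) \<le> (\<Sum>x\<in>cube d. norm (f x))"
  unfolding cube_poly_def
  by (rule order_trans[OF norm_sum]) (simp add: norm_mult norm_torus_char)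

lemma integrable_cube_poly_powr:
  assumes "q > 0"
  shows "integrable (torus d) (\<lambda>\<xi>. norm (cube_poly d f \<xi>) powr q)"
proof -
  interpret prob_space "torus d" by (rule prob_space_torus)
  show ?thesis
    by (rule integrable_const_bound[of _ "(\<Sum>x\<in>cube d. norm (f x)) powr q"])
       (use assms norm_cube_poly_le in \<open>auto intro!: powr_mono2\<close>)
qed

lemma cube_poly_Suc:
  "cube_poly (Suc d) f (\<xi>(d := y)) =
     cube_poly d (\<lambda>x. f (x(d := 0))) \<xi> + cube_poly d (\<lambda>x. f (x(d := 1))) \<xi> * cis (- (2 * pi * y))"
  by (simp add: cube_poly_def sum_cube_Suc torus_char_Suc sum.distrib sum_distrib_left sum_distrib_right mult_ac)

text \<open>The strict bound on \<open>S\<close> leaves room to split it into two positive parts, as Minkowski's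
  inequality requires.\<close>
lemma cube_poly_norm_le:
  assumes q: "p \<le> q" and p: "1 < p" "p \<le> 2" and B: "gen_binomial q (q / 2) \<le> 2 powr (q / p)"
    and S: "(\<Sum>x\<in>cube d. norm (f x) powr p) < S"
  shows "(LINT \<xi>|torus d. norm (cube_poly d f \<xi>) powr q) \<le> S powr (q / p)"
  using S
proof (induction d arbitrary: f S)
  case 0
  interpret prob_space "torus 0" by (rule prob_space_torus)
  have c: "cube 0 = {\<lambda>_. undefined}" by (simp add: cube_def)
  define a where "a = norm (f (\<lambda>_. undefined))"
  have "(LINT \<xi>|torus 0. norm (cube_poly 0 f \<xi>) powr q) = a powr q"
    by (simp add: cube_poly_def torus_char_def c a_def prob_space)
  also have "\<dots> = (a powr p) powr (q / p)" using p by (simp add: powr_powr a_def)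
  also have "\<dots> \<le> S powr (q / p)"
    using 0 p q by (intro powr_mono2) (auto simp: c a_def)
  finally show ?case .
next
  case (Suc d)
  interpret prob_space "torus d" by (rule prob_space_torus)
  define f0 where "f0 x = f (x(d := 0))" for x
  define f1 where "f1 x = f (x(d := 1))" for x
  define \<Sigma>0 where "\<Sigma>0 = (\<Sum>x\<in>cube d. norm (f0 x) powr p)"
  define \<Sigma>1 where "\<Sigma>1 = (\<Sum>x\<in>cube d. norm (f1 x) powr p)"
  have \<Sigma>: "\<Sigma>0 + \<Sigma>1 < S"
    using Suc.prems by (simp add: sum_cube_Suc sum.distrib \<Sigma>0_def \<Sigma>1_def f0_def f1_def)
  define e where "e = (S - \<Sigma>0 - \<Sigma>1) / 2"
  have e: "e > 0" using \<Sigma> by (simp add: e_def)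
  have nn: "\<Sigma>0 \<ge> 0" "\<Sigma>1 \<ge> 0" by (auto simp: \<Sigma>0_def \<Sigma>1_def intro: sum_nonneg)
  have SS: "(\<Sigma>0 + e) + (\<Sigma>1 + e) = S" by (simp add: e_def field_simps)
  have q0: "0 < q" using p q by simp
  let ?A = "cube_poly d f0" and ?B = "cube_poly d f1"
  have eqp: "(norm z powr p) powr (q / p) = norm z powr q" for z :: complex using p by (simp add: powr_powr)
  have "(LINT \<xi>|torus (Suc d). norm (cube_poly (Suc d) f \<xi>) powr q) =
      (LINT \<xi>|torus d. LINT y|unit_interval. norm (?A \<xi> + ?B \<xi> * cis (- (2 * pi * y))) powr q)"
    by (subst integral_torus_Suc[OF integrable_cube_poly_powr[OF q0]])
       (simp add: cube_poly_Suc f0_def[abs_def] f1_def[abs_def])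
  also have "\<dots> \<le> (LINT \<xi>|torus d. (norm (?A \<xi>) powr p + norm (?B \<xi>) powr p) powr (q / p))"
  proof (rule integral_mono')
    show "integrable (torus d) (\<lambda>\<xi>. (norm (?A \<xi>) powr p + norm (?B \<xi>) powr p) powr (q / p))"
      using p q q0 by (intro integrable_powr_add) (auto simp: eqp intro!: integrable_cube_poly_powr)
    show "(LINT y|unit_interval. norm (?A \<xi> + ?B \<xi> * cis (- (2 * pi * y))) powr q) \<le> (norm (?A \<xi>) powr p + norm (?B \<xi>) powr p) powr (q / p)" for \<xi>
      by (rule two_point_inequality[OF q0 p B])
  qed auto
  \<comment> \<open>The triangle inequality in the space of exponent q/p >= 1, for the p-th powers
    of the two moduli. No constant is lost, so the bound does not deteriorate with
    \<open>d\<close>.\<close>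
  also have "\<dots> \<le> ((\<Sigma>0 + e) + (\<Sigma>1 + e)) powr (q / p)"
  proof (rule Minkowski_integral)
    show "(LINT \<xi>|torus d. (norm (?A \<xi>) powr p) powr (q / p)) \<le> (\<Sigma>0 + e) powr (q / p)"
      unfolding eqp by (rule Suc.IH) (use e in \<open>simp add: \<Sigma>0_def\<close>)
    show "(LINT \<xi>|torus d. (norm (?B \<xi>) powr p) powr (q / p)) \<le> (\<Sigma>1 + e) powr (q / p)"
      unfolding eqp by (rule Suc.IH) (use e in \<open>simp add: \<Sigma>1_def\<close>)
  qed (use p q q0 e nn in \<open>auto simp: eqp intro!: integrable_cube_poly_powr\<close>)
  finally show ?case unfolding SS .
qed

subsection \<open>Duality and product functions\<close>

text \<open>In \<open>ennreal\<close> one has 1/\<top> = 0 and 1/0 = \<top>. The equation therefore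
  excludes \<open>p' = 0\<close> and forces the range of \<open>p'\<close>.\<close>

lemma ennreal_conjugate_cases:
  fixes p p' :: ennreal
  assumes p: "1 \<le> p" and c: "1 / p + 1 / p' = 1"
  obtains "p = 1" "p' = \<top>" | "p = \<top>" "p' = 1"
    | a b where "p = ennreal a" "p' = ennreal b" "1 < a" "1 < b" "1 / a + 1 / b = 1"
proof -
  have inv: "1 / ennreal b = ennreal (1 / b)" if "b > 0" for b
    using divide_ennreal[of 1 b] that by simp
  show thesis
  proof (cases p rule: ennreal_cases)
    case (real a)
    have a: "a \<ge> 1" using p real by simp
    show thesis
    proof (cases p' rule: ennreal_cases)
      case (real b)
      have "b \<noteq> 0" using c real by (auto simp: ennreal_divide_zero)
      then have b: "b > 0" using real by simp
      have "ennreal (1 / a + 1 / b) = ennreal 1"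
        using c a b \<open>p = ennreal a\<close> real by (simp add: inv)
      then have ab: "1 / a + 1 / b = 1" using a b by (subst (asm) ennreal_inj) auto
      have "a > 1" "b > 1"
      proof -
        have "1 / b > 0" "1 / a > 0" using a b by auto
        then have "1 / a < 1" "1 / b < 1" using ab by linarith+
        then show "a > 1" "b > 1" using a b by (simp_all add: divide_less_eq)
      qed
      then show thesis using that(3) ab real \<open>p = ennreal a\<close> by blast
    next
      case top
      then have "ennreal (1 / a) = 1" using c a \<open>p = ennreal a\<close> by (simp add: inv)
      then have "a = 1" using a by (simp add: ennreal_eq_1)
      then show thesis using that(1) top real by simp
    qed
  next
    case top
    then have c': "1 / p' = 1" using c by simp
    have "p' = 1"
    proof (cases p' rule: ennreal_cases)
      case (real b)
      have "b \<noteq> 0" using c' real by (auto simp: ennreal_divide_zero)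
      then have b: "b > 0" using real by simp
      then have "ennreal (1 / b) = 1" using c' real by (simp add: inv)
      then show ?thesis using b real by (simp add: ennreal_eq_1)
    qed (use c' in simp)
    then show thesis using that(2) top by simp
  qed
qed

lemma Lp_norm_count_space_finite:
  assumes "finite A" "p > 0"
  shows "Lp_norm (count_space A) (ennreal p) f = (\<Sum>x\<in>A. norm (f x) powr p) powr (1 / p)"
  using assms by (simp add: Lp_norm_def lebesgue_integral_count_space_finite)

lemma Lp_norm_count_space_top_le:
  assumes "\<And>x. x \<in> A \<Longrightarrow> norm (f x) \<le> K" "0 \<le> K"
  shows "Lp_norm (count_space A) \<top> f \<le> K"
proof -
  have "esssup (count_space A) (\<lambda>x. ennreal (norm (f x))) \<le> ennreal K"
    using assms by (intro esssup_I) (auto simp: AE_count_space)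
  then show ?thesis using assms(2) by (simp add: Lp_norm_def enn2real_leI)
qed

lemma (in prob_space) bounded_Lp:
  assumes [measurable]: "f \<in> borel_measurable M" and K: "\<And>x. norm (f x) \<le> K" and s: "1 \<le> s"
  shows "f \<in> Lp_space M s" and "Lp_norm M s f \<le> K"
proof -
  have K0: "0 \<le> K" using K[of undefined] norm_ge_zero order_trans by blast
  have es: "esssup M (\<lambda>x. ennreal (norm (f x))) \<le> ennreal K"
    using K by (intro esssup_I) (auto intro!: ennreal_leI)
  then have t: "esssup M (\<lambda>x. ennreal (norm (f x))) < \<top>"
    using ennreal_less_top order_le_less_trans by blast
  then have top: "f \<in> Lp_space M \<top>" by (simp add: Lp_space_def)
  have ntop: "Lp_norm M \<top> f \<le> K" using es K0 by (simp add: Lp_norm_def enn2real_leI)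
  show "f \<in> Lp_space M s"
  proof (cases s rule: ennreal_cases)
    case (real r)
    then show ?thesis using Lp_space_mono(1)[OF _ _ top, of r] s by auto
  qed (use top in simp)
  show "Lp_norm M s f \<le> K"
  proof (cases s rule: ennreal_cases)
    case (real r)
    then show ?thesis using Lp_space_mono(2)[OF _ _ top, of r] s ntop by fastforce
  qed (use ntop in simp)
qed

lemma fourier_coeff_le_L1:
  assumes "g \<in> Lp_space (torus d) 1"
  shows "norm (fourier_coeff d g x) \<le> Lp_norm (torus d) 1 g"
proof -
  have "norm (fourier_coeff d g x) \<le> (LINT \<xi>|torus d. norm (g \<xi> * torus_char d x \<xi>))"
    unfolding fourier_coeff_char by (rule integral_norm_bound)
  then show ?thesis
    by (simp add: Lp_norm_def norm_mult norm_torus_char)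
qed

text \<open>Duality: \<open>f\<close> is the extremiser for the coefficients \<open>c\<close>, so
  that the sum of \<open>f x * c x\<close> and the sum of the p-th powers of |f| both equal
  \<open>N\<close>. The first sum is the integral of \<open>g\<close> times a cube polynomial, which
  Hoelder's inequality and \<open>cube_poly_norm_le\<close> estimate.\<close>

lemma fourier_restriction_bound:
  assumes q: "2 \<le> q" and p: "1 < p" "p \<le> 2" and B: "gen_binomial q (q / 2) \<le> 2 powr (q / p)"
    and conj: "1 < p'" "1 / p + 1 / p' = 1" "1 < q'" "1 / q + 1 / q' = 1"
    and g: "g \<in> Lp_space (torus d) (ennreal q')"
  shows "Lp_norm (count_space (cube d)) (ennreal p') (fourier_coeff d g) \<le> 2 * Lp_norm (torus d) (ennreal q') g"
proof -
  interpret prob_space "torus d" by (rule prob_space_torus)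
  have [measurable]: "g \<in> borel_measurable (torus d)" using g by (simp add: Lp_space_def)
  have ig: "integrable (torus d) (\<lambda>\<xi>. norm (g \<xi>) powr q')" using g conj by (simp add: Lp_space_def)
  have Lg: "Lp_norm (torus d) (ennreal q') g = (LINT \<xi>|torus d. norm (g \<xi>) powr q') powr (1 / q')" (is "?G = _")
    using conj by (simp add: Lp_norm_def)
  have G0: "?G \<ge> 0" by (simp add: Lg)
  define c where "c x = fourier_coeff d g x" for x
  define f where "f x = cnj (c x) * of_real (norm (c x) powr (p' - 2))" for x
  define N where "N = (\<Sum>x\<in>cube d. norm (c x) powr p')"
  have nf: "norm (f x) = norm (c x) powr (p' - 1)" for x
    using powr_add[of "norm (c x)" 1 "p' - 2"] by (cases "c x = 0") (simp_all add: f_def norm_mult)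
  have pp: "(p' - 1) * p = p'" using conj p by (simp add: field_simps)
  have fp: "norm (f x) powr p = norm (c x) powr p'" for x
    unfolding nf by (simp add: powr_powr pp)
  have cf: "f x * c x = of_real (norm (c x) powr p')" for x
  proof (cases "c x = 0")
    case False
    have "f x * c x = of_real ((norm (c x))\<^sup>2 * norm (c x) powr (p' - 2))"
      unfolding of_real_mult complex_norm_square by (simp add: f_def)
    also have "(norm (c x))\<^sup>2 * norm (c x) powr (p' - 2) = norm (c x) powr p'"
      using False by (simp add: powr_diff)
    finally show ?thesis .
  qed (simp add: f_def)
  have L: "Lp_norm (count_space (cube d)) (ennreal p') (fourier_coeff d g) = N powr (1 / p')"
    using conj by (simp add: Lp_norm_count_space_finite[OF finite_cube] N_def c_def)
  have N0: "N \<ge> 0" by (simp add: N_def sum_nonneg)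
  show ?thesis
  proof (cases "N = 0")
    case True
    then show ?thesis using G0 by (simp add: L)
  next
    case False
    then have N: "N > 0" using N0 by simp
    have i1: "integrable (torus d) (\<lambda>\<xi>. norm (g \<xi>) powr 1)"
      by (rule powr_mean_mono(1)[OF _ _ _ _ ig]) (use conj in auto)
    have ic: "integrable (torus d) (\<lambda>\<xi>. g \<xi> * torus_char d x \<xi>)" for x
      by (rule Bochner_Integration.integrable_bound[OF i1])
        (use measurable_torus_char[of d x] in \<open>auto simp: norm_mult norm_torus_char\<close>)
    \<comment> \<open>\<open>cube_poly_norm_le\<close> asks for a bound strictly above
      \<open>N\<close>. Taking \<open>2 * N\<close> costs the factor 2^(1/p) <= 2, which is the
      constant of the lemma.\<close>
    define T where "T = (2 * N) powr (1 / p)"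
    have T: "T > 0" using N by (simp add: T_def)
    have "(\<Sum>x\<in>cube d. norm (f x) powr p) < 2 * N" unfolding fp using N by (simp add: N_def)
    from cube_poly_norm_le[OF _ p B this]
    have "(LINT \<xi>|torus d. norm (cube_poly d f \<xi>) powr q) \<le> (2 * N) powr (q / p)" using p q by simp
    also have "\<dots> = T powr q" by (simp add: T_def powr_powr)
    finally have PT: "(LINT \<xi>|torus d. norm (cube_poly d f \<xi>) powr q) \<le> T powr q" .
    have "complex_of_real N = (\<Sum>x\<in>cube d. f x * c x)" by (simp add: N_def cf)
    also have "\<dots> = (LINT \<xi>|torus d. (\<Sum>x\<in>cube d. f x * (g \<xi> * torus_char d x \<xi>)))"
      using ic by (simp add: Bochner_Integration.integral_sum c_def fourier_coeff_char)
    also have "\<dots> = (LINT \<xi>|torus d. g \<xi> * cube_poly d f \<xi>)"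
      by (simp add: cube_poly_def sum_distrib_left mult_ac)
    finally have "N = norm (LINT \<xi>|torus d. g \<xi> * cube_poly d f \<xi>)"
      using N by (metis abs_of_pos norm_of_real)
    also have "\<dots> \<le> (LINT \<xi>|torus d. norm (g \<xi>) * norm (cube_poly d f \<xi>))"
      by (rule order_trans[OF integral_norm_bound]) (simp add: norm_mult)
    finally have N1: "N \<le> (LINT \<xi>|torus d. norm (g \<xi>) * norm (cube_poly d f \<xi>))" .
    \<comment> \<open>The norm \<open>?G\<close> is not known to be positive here, so Hoelder's
      inequality is used with every larger \<open>G\<close>.\<close>
    have "N / T \<le> G" if G: "?G < G" for G
    proof -
      have "G > 0" using G G0 by simp
      have "(LINT \<xi>|torus d. norm (g \<xi>) powr q') = ?G powr q'" using conj by (simp add: Lg powr_powr)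
      also have "\<dots> \<le> G powr q'" using G G0 conj by (intro powr_mono2) auto
      finally have "(LINT \<xi>|torus d. norm (g \<xi>) * norm (cube_poly d f \<xi>)) \<le> G * T"
        using q conj ig PT T \<open>G > 0\<close>
        by (intro Hoelder_integral(2)[of q' q]) (auto intro!: integrable_cube_poly_powr)
      with N1 have "N \<le> G * T" by simp
      then show ?thesis using T by (simp add: divide_le_eq)
    qed
    then have NT: "N / T \<le> ?G" by (rule dense_ge)
    have "1 / p' = 1 - 1 / p" using conj(2) by linarith
    then have "N powr (1 / p') = N powr (1 - 1 / p)" by (rule arg_cong)
    also have "\<dots> = 2 powr (1 / p) * (N / T)"
      using N by (simp add: T_def powr_diff powr_mult)
    also have "\<dots> \<le> 2 powr 1 * ?G"
      using p N T by (intro mult_mono NT powr_mono) auto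
    finally show ?thesis by (simp add: L)
  qed
qed

section \<open>Tensor powers of a one-dimensional function\<close>

lemma powr_power_swap:
  fixes a e :: real
  assumes "0 \<le> a"
  shows "(a powr e) ^ n = (a ^ n) powr e"
  using assms by (induction n) (simp_all add: powr_mult)

text \<open>If R < x with R > 0, the powers of x/R would exceed the fixed constant
  \<open>C\<close>.\<close>

lemma le_of_power_le_mult_power:
  fixes x R C :: real
  assumes "0 \<le> x" "0 \<le> R" and le: "\<And>d. 0 < d \<Longrightarrow> x ^ d \<le> C * R ^ d"
  shows "x \<le> R"
proof (rule ccontr)
  assume "\<not> x \<le> R"
  then have xR: "R < x" by simp
  show False
  proof (cases "R = 0")
    case True
    then show ?thesis using le[of 1] xR by simp
  next
    case False
    then have R: "R > 0" using assms by simp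
    then obtain n where n: "C < (x / R) ^ n" using xR real_arch_pow[of "x / R" C] by auto
    \<comment> \<open>The exponent \<open>n\<close> may be 0, whereas the hypothesis speaks of
      positive exponents only.\<close>
    also have "\<dots> \<le> (x / R) ^ Suc n" using xR R by (intro power_increasing) auto
    finally have "C * R ^ Suc n < x ^ Suc n" using R by (simp add: power_divide field_simps del: power_Suc)
    then show False using le[of "Suc n"] by simp
  qed
qed

lemma sum_cube_prod:
  fixes h :: "int \<Rightarrow> 'b::comm_semiring_1"
  shows "(\<Sum>x\<in>cube d. \<Prod>i<d. h (x i)) = (h 0 + h 1) ^ d"
proof (induction d)
  case 0
  show ?case by (simp add: cube_def)
next
  case (Suc d)
  have "(\<Prod>i<d. h ((x(d := b)) i)) = (\<Prod>i<d. h (x i))" for x b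
    by (intro prod.cong) auto
  then show ?case
    by (simp add: sum_cube_Suc sum.distrib sum_distrib_right[symmetric] sum_distrib_left[symmetric] Suc.IH algebra_simps)
qed

definition torus_product :: "nat \<Rightarrow> (real \<Rightarrow> complex) \<Rightarrow> (nat \<Rightarrow> real) \<Rightarrow> complex" where
  "torus_product d \<gamma> \<xi> = (\<Prod>i<d. \<gamma> (\<xi> i))"

lemma measurable_torus_product:
  "\<gamma> \<in> borel_measurable unit_interval \<Longrightarrow> torus_product d \<gamma> \<in> borel_measurable (torus d)"
  unfolding torus_product_def by (intro borel_measurable_prod measurable_torus_component) auto

lemma norm_torus_product_le:
  assumes "\<And>y. norm (\<gamma> y) \<le> K"
  shows "norm (torus_product d \<gamma> \<xi>) \<le> K ^ d"
proof -
  have "(\<Prod>i<d. norm (\<gamma> (\<xi> i))) \<le> (\<Prod>i<d. K)" using assms by (intro prod_mono) auto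
  then show ?thesis by (simp add: torus_product_def prod_norm)
qed

lemma fourier_coeff_torus_product:
  assumes [measurable]: "\<gamma> \<in> borel_measurable unit_interval" and K: "\<And>y. norm (\<gamma> y) \<le> K"
  shows "fourier_coeff d (torus_product d \<gamma>) x = (\<Prod>i<d. LINT y|unit_interval. \<gamma> y * cis (- (2 * pi * (of_int (x i) * y))))"
proof -
  have "(\<lambda>y. cis (- (2 * pi * (of_int k * y)))) \<in> borel_measurable unit_interval" for k :: int
    by (intro borel_measurable_unit_interval_continuous) (auto intro!: continuous_intros)
  then have "integrable unit_interval (\<lambda>y. \<gamma> y * cis (- (2 * pi * (of_int k * y))))" for k :: int
    by (intro unit_interval.integrable_const_bound[of _ K]) (use K in \<open>auto simp: norm_mult\<close>)
  then show ?thesis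
    unfolding fourier_coeff_char torus_product_def torus_char_def prod.distrib[symmetric]
    by (intro integral_torus_prod)
qed

lemma Lp_norm_torus_product:
  assumes [measurable]: "\<gamma> \<in> borel_measurable unit_interval" and K: "\<And>y. norm (\<gamma> y) \<le> K" and s: "0 < s"
  shows "Lp_norm (torus d) (ennreal s) (torus_product d \<gamma>) = ((LINT y|unit_interval. norm (\<gamma> y) powr s) powr (1 / s)) ^ d"
proof -
  have "integrable unit_interval (\<lambda>y. norm (\<gamma> y) powr s)"
    by (intro unit_interval.integrable_const_bound[of _ "K powr s"]) (use K s in \<open>auto intro!: powr_mono2\<close>)
  then have "(LINT \<xi>|torus d. (\<Prod>i<d. norm (\<gamma> (\<xi> i)) powr s)) = (\<Prod>i<d. LINT y|unit_interval. norm (\<gamma> y) powr s)"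
    by (intro integral_torus_prod)
  then have "(LINT \<xi>|torus d. norm (torus_product d \<gamma> \<xi>) powr s) = (LINT y|unit_interval. norm (\<gamma> y) powr s) ^ d"
    by (simp add: torus_product_def prod_norm[symmetric] prod_powr_distrib)
  then show ?thesis
    using s by (simp add: Lp_norm_def powr_power_swap)
qed

text \<open>On tensor powers the left side of the estimate is an exact d-th power and the right side
  at most \<open>C * R ^ d\<close>, so letting \<open>d\<close> grow removes \<open>C\<close>. A
  multiplicative bound \<open>R\<close> replaces the norm of \<open>\<gamma>\<close>, which lets a
  supremum bound serve for every \<open>s\<close>, including \<top>.\<close>

lemma one_dim_necessary:
  assumes bd: "\<And>d g. 0 < d \<Longrightarrow> g \<in> Lp_space (torus d) s \<Longrightarrow>
      Lp_norm (count_space (cube d)) (ennreal p') (fourier_coeff d g) \<le> C * Lp_norm (torus d) s g"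
    and s: "1 \<le> s" and C: "0 < C" and p': "0 < p'"
    and m: "\<gamma> \<in> borel_measurable unit_interval" and K: "\<And>y. norm (\<gamma> y) \<le> K"
    and R: "0 \<le> R" "\<And>d. Lp_norm (torus d) s (torus_product d \<gamma>) \<le> R ^ d"
  shows "norm (LINT y|unit_interval. \<gamma> y) powr p' + norm (LINT y|unit_interval. \<gamma> y * cis (- (2 * pi * y))) powr p' \<le> R powr p'"
proof -
  define h where "h k = norm (LINT y|unit_interval. \<gamma> y * cis (- (2 * pi * (of_int k * y)))) powr p'" for k :: int
  define a where "a = h 0 + h 1"
  have a0: "a \<ge> 0" by (simp add: a_def h_def)
  have "a powr (1 / p') \<le> R"
  proof (rule le_of_power_le_mult_power[of _ _ C])
    fix d :: nat assume d: "0 < d"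
    interpret prob_space "torus d" by (rule prob_space_torus)
    have "(a powr (1 / p')) ^ d = (a ^ d) powr (1 / p')"
      by (rule powr_power_swap[OF a0])
    also have "a ^ d = (\<Sum>x\<in>cube d. norm (fourier_coeff d (torus_product d \<gamma>) x) powr p')"
      unfolding a_def sum_cube_prod[symmetric] fourier_coeff_torus_product[OF m K]
      by (simp add: h_def prod_norm[symmetric] prod_powr_distrib)
    also have "\<dots> powr (1 / p') = Lp_norm (count_space (cube d)) (ennreal p') (fourier_coeff d (torus_product d \<gamma>))"
      by (rule Lp_norm_count_space_finite[OF finite_cube p', symmetric])
    also have "\<dots> \<le> C * Lp_norm (torus d) s (torus_product d \<gamma>)"
      by (intro bd d bounded_Lp(1)[of _ "K ^ d"] measurable_torus_product m norm_torus_product_le K s)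
    also have "\<dots> \<le> C * R ^ d" using C R(2) by (intro mult_left_mono) auto
    finally show "(a powr (1 / p')) ^ d \<le> C * R ^ d" .
  qed (use R in auto)
  then have "(a powr (1 / p')) powr p' \<le> R powr p'" using p' by (intro powr_mono2) auto
  then show ?thesis using p' a0 by (simp add: powr_powr a_def h_def)
qed

subsection \<open>Necessary conditions\<close>

text \<open>By orthogonality only the term of frequency 0 survives each integral.\<close>

lemma trig_coefficients:
  fixes \<alpha> \<beta> :: complex
  defines "\<gamma> \<equiv> (\<lambda>y. 1 + \<alpha> * cis (2 * pi * y) + \<beta> * cis (- (2 * pi * y)))"
  shows "(LINT y|unit_interval. \<gamma> y) = 1"
    and "(LINT y|unit_interval. \<gamma> y * cis (- (2 * pi * y))) = \<alpha>"
proof -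
  have i: "integrable unit_interval (\<lambda>y. cis (2 * pi * of_int k * y))" for k :: int
    by (intro integrable_unit_interval_continuous) (auto intro!: continuous_intros)
  have e: "(LINT y|unit_interval. a * cis (2 * pi * of_int k * y) + b * cis (2 * pi * of_int l * y) + c * cis (2 * pi * of_int m * y))
     = a * of_bool (k = 0) + b * of_bool (l = 0) + c * of_bool (m = 0)" for a b c :: complex and k l m :: int
    by (simp add: i integral_cis_unit_interval)
  have "\<gamma> = (\<lambda>y. 1 * cis (2 * pi * of_int 0 * y) + \<alpha> * cis (2 * pi * of_int 1 * y) + \<beta> * cis (2 * pi * of_int (-1) * y))"
    by (simp add: \<gamma>_def)
  then show "(LINT y|unit_interval. \<gamma> y) = 1" by (simp only: e) simp
  have "(\<lambda>y. \<gamma> y * cis (- (2 * pi * y))) =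
      (\<lambda>y. \<alpha> * cis (2 * pi * of_int 0 * y) + 1 * cis (2 * pi * of_int (-1) * y) + \<beta> * cis (2 * pi * of_int (-2) * y))"
    by (simp add: \<gamma>_def fun_eq_iff distrib_right mult.assoc cis_mult, simp add: mult.commute)
  then show "(LINT y|unit_interval. \<gamma> y * cis (- (2 * pi * y))) = \<alpha>" by (simp only: e) simp
qed

lemma small_power_exceeds_square:
  fixes p :: real
  assumes "0 < p" "p < 2"
  obtains t :: real where "0 < t" "t\<^sup>2 < (t / 2) powr p"
proof -
  \<comment> \<open>The claim amounts to t^(2-p) < 2^(-p); this \<open>t\<close> makes the left side
    equal to 2^(-(p+1)).\<close>
  define t :: real where "t = 2 powr (- ((p + 1) / (2 - p)))"
  have t: "t > 0" by (simp add: t_def)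
  have "t powr (2 - p) = 2 powr (- (p + 1))" using assms by (simp add: t_def powr_powr)
  also have "\<dots> < 2 powr (- p)" by simp
  finally have "t powr (2 - p) * t powr p < 2 powr (- p) * t powr p" using t by simp
  then have "t\<^sup>2 < (t / 2) powr p" using t by (simp add: powr_divide powr_minus field_simps flip: powr_add)
  with t show thesis by (rule that)
qed

text \<open>The test function is 1 + i t sin(2 pi y), with supremum norm at most sqrt(1 + t^2) and
  coefficients 1 and t/2. For p' < 2 the estimate would give 1 + (t/2)^p' <= (1 + t^2)^(p'/2) <= 1 +
  t^2, which fails for small \<open>t\<close>.\<close>

lemma necessary_half:
  assumes bd: "\<And>d g. 0 < d \<Longrightarrow> g \<in> Lp_space (torus d) s \<Longrightarrow>
      Lp_norm (count_space (cube d)) (ennreal p') (fourier_coeff d g) \<le> C * Lp_norm (torus d) s g"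
    and s: "1 \<le> s" and C: "0 < C" and p': "0 < p'"
  shows "2 \<le> p'"
proof (rule ccontr)
  assume "\<not> 2 \<le> p'"
  then obtain t where t: "0 < t" "t\<^sup>2 < (t / 2) powr p'" using small_power_exceeds_square[of p'] p' by auto
  define \<gamma> where "\<gamma> y = 1 + of_real (t / 2) * cis (2 * pi * y) + (- of_real (t / 2)) * cis (- (2 * pi * y))" for y
  have K: "norm (\<gamma> y) \<le> sqrt (1 + t\<^sup>2)" for y
  proof -
    have "Re (\<gamma> y) = 1" "Im (\<gamma> y) = t * sin (2 * pi * y)" by (simp_all add: \<gamma>_def)
    moreover have "(t * sin (2 * pi * y))\<^sup>2 \<le> t\<^sup>2"
      using abs_sin_le_one[of "2 * pi * y"] by (simp add: power_mult_distrib mult_left_le abs_square_le_1)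
    ultimately show ?thesis by (simp add: cmod_def)
  qed
  have m: "\<gamma> \<in> borel_measurable unit_interval"
    unfolding \<gamma>_def[abs_def] by (intro borel_measurable_unit_interval_continuous) (auto intro!: continuous_intros)
  have R: "Lp_norm (torus d) s (torus_product d \<gamma>) \<le> sqrt (1 + t\<^sup>2) ^ d" for d
  proof -
    interpret prob_space "torus d" by (rule prob_space_torus)
    show ?thesis by (intro bounded_Lp(2) measurable_torus_product m norm_torus_product_le K s)
  qed
  have I: "(LINT y|unit_interval. \<gamma> y) = 1" "(LINT y|unit_interval. \<gamma> y * cis (- (2 * pi * y))) = of_real (t / 2)"
    unfolding \<gamma>_def[abs_def] by (rule trig_coefficients)+
  from one_dim_necessary[OF bd s C p' m K _ R]
  have "1 + (t / 2) powr p' \<le> sqrt (1 + t\<^sup>2) powr p'"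
    unfolding I norm_of_real using t(1) by simp
  also have "\<dots> = (1 + t\<^sup>2) powr (p' / 2)"
    by (simp add: powr_half_sqrt[symmetric] powr_powr)
  also have "\<dots> \<le> (1 + t\<^sup>2) powr 1" using \<open>\<not> 2 \<le> p'\<close> by (intro powr_mono) auto
  finally show False using t by simp
qed

text \<open>The function 1 + cos(2 pi y) is nonnegative, so its norm equals its mean 1. The
  coefficient at frequency 0 already exhausts this bound, and the one at frequency 1 is 1/2.\<close>

lemma not_bounded_L1:
  assumes bd: "\<And>d g. 0 < d \<Longrightarrow> g \<in> Lp_space (torus d) 1 \<Longrightarrow>
      Lp_norm (count_space (cube d)) (ennreal p') (fourier_coeff d g) \<le> C * Lp_norm (torus d) 1 g"
    and C: "0 < C" and p': "0 < p'"
  shows False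
proof -
  define \<gamma> where "\<gamma> y = 1 + of_real (1 / 2) * cis (2 * pi * y) + of_real (1 / 2) * cis (- (2 * pi * y))" for y
  have \<gamma>: "\<gamma> y = of_real (1 + cos (2 * pi * y))" for y
    by (simp add: \<gamma>_def complex_eq_iff)
  have n\<gamma>: "norm (\<gamma> y) = 1 + cos (2 * pi * y)" for y
    unfolding \<gamma> norm_of_real using cos_ge_minus_one[of "2 * pi * y"] by linarith
  have K: "norm (\<gamma> y) \<le> 2" for y unfolding n\<gamma> using cos_le_one[of "2 * pi * y"] by linarith
  have m: "\<gamma> \<in> borel_measurable unit_interval"
    unfolding \<gamma>_def[abs_def] by (intro borel_measurable_unit_interval_continuous) (auto intro!: continuous_intros)
  have I: "(LINT y|unit_interval. \<gamma> y) = 1" "(LINT y|unit_interval. \<gamma> y * cis (- (2 * pi * y))) = of_real (1 / 2)"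
    unfolding \<gamma>_def[abs_def] by (rule trig_coefficients)+
  have "complex_of_real (LINT y|unit_interval. norm (\<gamma> y)) = (LINT y|unit_interval. \<gamma> y)"
  proof -
    have "complex_of_real (norm (\<gamma> y)) = \<gamma> y" for y unfolding n\<gamma> by (rule \<gamma>[symmetric])
    then show ?thesis unfolding integral_complex_of_real[symmetric] by (simp only:)
  qed
  then have n1: "(LINT y|unit_interval. norm (\<gamma> y)) = 1" unfolding I by simp
  have R: "Lp_norm (torus d) 1 (torus_product d \<gamma>) \<le> 1 ^ d" for d
    using Lp_norm_torus_product[OF m K, of 1 d] n1 by simp
  from one_dim_necessary[OF bd _ C p' m K _ R] have "1 + (1 / 2) powr p' \<le> 1 powr p'"
    unfolding I by simp
  moreover have "(1 / 2) powr p' > 0" by simp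
  ultimately show False by simp
qed

text \<open>For the dual extremiser \<open>\<gamma>\<close> of \<open>w\<close>, |\<gamma>|^q' =
  |w|^q has integral \<open>?B\<close>. Its two coefficients are conjugate to each other and add up
  to the integral of \<gamma> w, again \<open>?B\<close>, so each has modulus at least
  \<open>?B / 2\<close>. Hence 2 (B/2)^p' <= B^(p'/q'), which rearranges to the claim.\<close>

lemma necessary_binomial:
  assumes bd: "\<And>d g. 0 < d \<Longrightarrow> g \<in> Lp_space (torus d) (ennreal q') \<Longrightarrow>
      Lp_norm (count_space (cube d)) (ennreal p') (fourier_coeff d g) \<le> C * Lp_norm (torus d) (ennreal q') g"
    and C: "0 < C" and p': "0 < p'" and q: "2 \<le> q" "1 < q'" "1 / q + 1 / q' = 1"
  shows "gen_binomial q (q / 2) powr (1 / q) \<le> 2 powr (1 - 1 / p')"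
proof -
  let ?B = "gen_binomial q (q / 2)"
  have Bpos: "?B > 0" using q unfolding gen_binomial_def by (intro divide_pos_pos mult_pos_pos Gamma_real_pos) auto
  define w where "w y = 1 + cis (- (2 * pi * y))" for y
  define \<gamma> where "\<gamma> y = of_real (norm (w y) powr (q - 2)) * cnj (w y)" for y
  have n\<gamma>: "norm (\<gamma> y) = norm (w y) powr (q - 1)" for y
    using powr_add[of "norm (w y)" 1 "q - 2"] by (cases "w y = 0") (simp_all add: \<gamma>_def norm_mult mult.commute)
  have w2: "norm (w y) \<le> 2" for y unfolding w_def by (rule order_trans[OF norm_triangle_ineq]) simp
  have K: "norm (\<gamma> y) \<le> 2 powr (q - 1)" for y
    unfolding n\<gamma> using q w2 by (intro powr_mono2) auto
  have cw: "continuous_on UNIV w" unfolding w_def by (intro continuous_intros)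
  have mw [measurable]: "w \<in> borel_measurable unit_interval" by (rule borel_measurable_unit_interval_continuous[OF cw])
  have m [measurable]: "\<gamma> \<in> borel_measurable unit_interval"
  proof -
    have "(\<lambda>y. cnj (w y)) \<in> borel_measurable unit_interval"
      by (intro borel_measurable_unit_interval_continuous continuous_intros cw)
    moreover have "(\<lambda>y. norm (w y) powr (q - 2)) \<in> borel_measurable unit_interval" by measurable
    ultimately show ?thesis
      unfolding \<gamma>_def[abs_def] by (intro borel_measurable_times measurable_compose[OF _ borel_measurable_of_real])
  qed
  have mc: "(\<lambda>y. cis (- (2 * pi * y))) \<in> borel_measurable unit_interval"
    by (intro borel_measurable_unit_interval_continuous continuous_intros)
  have qq: "(q - 1) * q' = q" using q by (simp add: field_simps)
  have B: "(LINT y|unit_interval. norm (w y) powr q) = ?B"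
    using circle_moment_one[of q] q by (simp add: circle_moment_def w_def)
  have R: "Lp_norm (torus d) (ennreal q') (torus_product d \<gamma>) \<le> (?B powr (1 / q')) ^ d" for d
    using Lp_norm_torus_product[OF m K, of q' d] q by (simp add: n\<gamma> powr_powr qq B)
  let ?a = "LINT y|unit_interval. \<gamma> y" and ?b = "LINT y|unit_interval. \<gamma> y * cis (- (2 * pi * y))"
  \<comment> \<open>Multiplication by this exponential turns \<open>cnj (w y)\<close> into
    \<open>w y\<close>.\<close>
  have "\<gamma> y * cis (- (2 * pi * y)) = cnj (\<gamma> y)" for y
    by (simp add: \<gamma>_def w_def mult.assoc distrib_right cis_cnj cis_mult add.commute)
  then have b: "?b = cnj ?a" by (simp add: integral_cnj)
  have ia: "integrable unit_interval \<gamma>"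
    by (rule unit_interval.integrable_const_bound[of _ "2 powr (q - 1)"]) (use K in auto)
  have ib: "integrable unit_interval (\<lambda>y. \<gamma> y * cis (- (2 * pi * y)))"
    by (rule unit_interval.integrable_const_bound[of _ "2 powr (q - 1)"]) (use K mc in \<open>auto simp: norm_mult\<close>)
  have "\<gamma> y * w y = of_real (norm (w y) powr q)" for y
  proof (cases "w y = 0")
    case False
    have "\<gamma> y * w y = of_real (norm (w y) powr (q - 2)) * (w y * cnj (w y))" by (simp add: \<gamma>_def mult_ac)
    also have "w y * cnj (w y) = of_real ((norm (w y))\<^sup>2)" by (rule complex_norm_square[symmetric])
    also have "of_real (norm (w y) powr (q - 2)) * complex_of_real ((norm (w y))\<^sup>2) = of_real (norm (w y) powr q)"
      unfolding of_real_mult[symmetric] using False by (simp add: powr_diff)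
    finally show ?thesis .
  qed (use q in simp)
  then have "of_real ?B = (LINT y|unit_interval. \<gamma> y * w y)" by (simp add: B)
  also have "\<dots> = (LINT y|unit_interval. \<gamma> y + \<gamma> y * cis (- (2 * pi * y)))"
    by (simp add: w_def distrib_left)
  also have "\<dots> = ?a + ?b" by (rule Bochner_Integration.integral_add[OF ia ib])
  finally have "complex_of_real ?B = ?a + ?b" .
  then have "?B = norm (?a + ?b)" using Bpos by (metis abs_of_pos norm_of_real)
  also have "\<dots> \<le> norm ?a + norm ?b" by (rule norm_triangle_ineq)
  finally have a2: "?B / 2 \<le> norm ?a" unfolding b by simp
  have "2 * (?B / 2) powr p' \<le> norm ?a powr p' + norm ?b powr p'"
    unfolding b using a2 Bpos p' powr_mono2[of p' "?B / 2" "norm ?a"] by simp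
  also have "\<dots> \<le> (?B powr (1 / q')) powr p'"
    using one_dim_necessary[OF bd _ C p' m K _ R] q by simp
  finally have "(2 * (?B / 2) powr p') powr (1 / p') \<le> ((?B powr (1 / q')) powr p') powr (1 / p')"
    using p' by (intro powr_mono2) auto
  then have "2 powr (1 / p') * (?B / 2) \<le> ?B powr (1 / q')"
    using p' Bpos by (simp add: powr_mult powr_powr)
  also have "1 / q' = 1 - 1 / q" using q by linarith
  also have "?B powr (1 - 1 / q) = ?B / ?B powr (1 / q)" using Bpos by (simp add: powr_diff)
  finally have "2 powr (1 / p') * ?B powr (1 / q) \<le> 2" using Bpos by (simp add: field_simps)
  then show ?thesis by (simp add: powr_diff field_simps)
qed

section \<open>Size of the central binomial coefficient, and the equivalence\<close>

lemma gen_binomial_two: "gen_binomial 2 (2 / 2) = 2"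
  using Gamma_numeral[of "num.Bit1 num.One", where 'a = real] Gamma_numeral[of "num.Bit0 num.One", where 'a = real]
  by (simp add: gen_binomial_def fact_numeral)

text \<open>B^(1/q) is the norm of exponent q of 1 + e(-y). On a probability space it lies between
  the norm of exponent 2, which is sqrt 2, and the supremum 2.\<close>

lemma gen_binomial_bounds:
  assumes q: "2 \<le> q"
  shows "2 powr (1 / 2) \<le> gen_binomial q (q / 2) powr (1 / q)" and "gen_binomial q (q / 2) powr (1 / q) \<le> 2"
    and "gen_binomial q (q / 2) > 0"
proof -
  let ?w = "\<lambda>y. norm (1 + 1 * cis (- (2 * pi * y)))"
  have B: "(LINT y|unit_interval. ?w y powr r) = gen_binomial r (r / 2)" if "r > 0" for r
    using circle_moment_one[OF that] by (simp add: circle_moment_def)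
  have mw: "?w \<in> borel_measurable unit_interval"
    by (intro borel_measurable_unit_interval_continuous continuous_intros)
  have w2: "?w y \<le> 2" for y by (rule order_trans[OF norm_triangle_ineq]) simp
  have w2q: "?w y powr q \<le> 2 powr q" for y using w2 q by (intro powr_mono2) auto
  have int: "integrable unit_interval (\<lambda>y. ?w y powr q)"
    using q by (intro integrable_unit_interval_continuous continuous_on_powr' continuous_intros) auto
  have "(LINT y|unit_interval. ?w y powr 2) powr (1 / 2) \<le> (LINT y|unit_interval. ?w y powr q) powr (1 / q)"
    by (rule unit_interval.powr_mean_mono(2)[OF _ q mw _ int]) auto
  then show "2 powr (1 / 2) \<le> gen_binomial q (q / 2) powr (1 / q)" using q gen_binomial_two by (simp only: B)
  show pos: "gen_binomial q (q / 2) > 0"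
    using q unfolding gen_binomial_def by (intro divide_pos_pos mult_pos_pos Gamma_real_pos) auto
  have "(LINT y|unit_interval. ?w y powr q) \<le> (LINT y|unit_interval. 2 powr q)"
    using w2q int by (intro integral_mono) auto
  then have "gen_binomial q (q / 2) \<le> 2 powr q" using B[of q] q unit_interval.prob_space by simp
  then have "gen_binomial q (q / 2) powr (1 / q) \<le> (2 powr q) powr (1 / q)" using q pos by (intro powr_mono2) auto
  then show "gen_binomial q (q / 2) powr (1 / q) \<le> 2" using q by (simp add: powr_powr)
qed

lemma log_binomial_le_iff:
  assumes q: "2 \<le> q"
  shows "1 / q * log 2 (gen_binomial q (q / 2)) \<le> x \<longleftrightarrow> gen_binomial q (q / 2) powr (1 / q) \<le> 2 powr x"
proof -
  let ?B = "gen_binomial q (q / 2)"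
  have B: "?B > 0" by (rule gen_binomial_bounds(3)[OF q])
  have "1 / q * log 2 ?B = log 2 (?B powr (1 / q))" using B by (simp add: log_powr)
  then show ?thesis using B by (simp add: log_le_iff)
qed

theorem corollary3:
  fixes p q p' q' :: ennreal
  assumes "1 \<le> p" and "1 \<le> q"
    and "1 / p + 1 / p' = 1" and "1 / q + 1 / q' = 1"
  shows "(\<exists>C::real. 0 < C \<and>
            (\<forall>d::nat. 0 < d \<longrightarrow>
              (\<forall>g \<in> Lp_space (torus d) q'.
                Lp_norm (count_space (cube d)) p' (fourier_coeff d g) \<le> C * Lp_norm (torus d) q' g)))
         \<longleftrightarrow>
         enn2real (1 / p) \<ge>
           (if q = \<top> then 1
            else if 2 \<le> q then
              1 / enn2real q * log 2 (gen_binomial (enn2real q) (enn2real q / 2))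
            else 1 / 2)"
    (is "?bounded \<longleftrightarrow> enn2real (1 / p) \<ge> ?L")
proof -
  have q'1: "1 \<le> q'"
    using assms(2,4) by (cases rule: ennreal_conjugate_cases) (auto simp: ennreal_ge_1)
  have inv: "enn2real (1 / ennreal a) = 1 / a" if "a > 0" for a
    using divide_ennreal[of 1 a] that by simp
  \<comment> \<open>The threshold never exceeds 1, so the condition always holds for p = 1.\<close>
  have L1: "?L \<le> 1"
  proof -
    have "1 / r * log 2 (gen_binomial r (r / 2)) \<le> 1" if "2 \<le> r" for r
      using log_binomial_le_iff[OF that, of 1] gen_binomial_bounds[OF that] by simp
    moreover have "2 \<le> enn2real q" if "2 \<le> q" "q \<noteq> \<top>"
      using that by (metis enn2real_mono enn2real_numeral less_top)
    ultimately show ?thesis by auto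
  qed
  \<comment> \<open>The threshold is at least 1/2, so the condition always fails for p = \<top> and
    otherwise entails p <= 2.\<close>
  have L2: "1 / 2 \<le> ?L"
  proof -
    have "1 / 2 \<le> 1 / r * log 2 (gen_binomial r (r / 2))" if "2 \<le> r" for r
    proof (rule ccontr)
      assume "\<not> ?thesis"
      then have "1 / r * log 2 (gen_binomial r (r / 2)) < 1 / 2" by simp
      moreover have "2 powr (1 / 2) \<le> 2 powr (1 / r * log 2 (gen_binomial r (r / 2)))"
        using gen_binomial_bounds[OF that] by (simp add: log_powr[symmetric])
      ultimately show False by simp
    qed
    moreover have "2 \<le> enn2real q" if "2 \<le> q" "q \<noteq> \<top>"
      using that by (metis enn2real_mono enn2real_numeral less_top)
    ultimately show ?thesis by auto
  qed
  show ?thesis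
    using assms(1,3)
  proof (cases rule: ennreal_conjugate_cases)
    case 1
    \<comment> \<open>Here p' = \<top>, and every coefficient is at most the norm of exponent 1,
      hence at most the norm of exponent q'.\<close>
    have "Lp_norm (count_space (cube d)) p' (fourier_coeff d g) \<le> 1 * Lp_norm (torus d) q' g"
      if g: "g \<in> Lp_space (torus d) q'" for d g
    proof -
      interpret prob_space "torus d" by (rule prob_space_torus)
      have "g \<in> Lp_space (torus d) 1" "Lp_norm (torus d) 1 g \<le> Lp_norm (torus d) q' g"
        using Lp_space_mono[OF _ _ g, of 1] q'1 by auto
      moreover from this(1) have "norm (fourier_coeff d g x) \<le> Lp_norm (torus d) 1 g" for x
        by (rule fourier_coeff_le_L1)
      ultimately show ?thesis
        unfolding 1 by (intro Lp_norm_count_space_top_le) (auto intro: order_trans[OF norm_ge_zero] order_trans)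
    qed
    then have ?bounded by (intro exI[of _ 1]) auto
    then show ?thesis using L1 1 by simp
  next
    case 2
    \<comment> \<open>Here p' = 1, which is below the value 2 that boundedness requires.\<close>
    have "\<not> ?bounded"
    proof
      assume ?bounded
      then obtain C where C: "0 < C" "\<And>d g. 0 < d \<Longrightarrow> g \<in> Lp_space (torus d) q' \<Longrightarrow>
        Lp_norm (count_space (cube d)) (ennreal 1) (fourier_coeff d g) \<le> C * Lp_norm (torus d) q' g"
        using 2 by auto
      then show False using necessary_half[OF C(2) q'1 C(1)] by simp
    qed
    then show ?thesis using L2 2 by simp
  next
    case (3 P P')
    have ip: "enn2real (1 / p) = 1 / P" using 3 by (simp add: inv)
    show ?thesis
    proof
      assume ?bounded
      then obtain C where C: "0 < C" "\<And>d g. 0 < d \<Longrightarrow> g \<in> Lp_space (torus d) q' \<Longrightarrow>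
        Lp_norm (count_space (cube d)) (ennreal P') (fourier_coeff d g) \<le> C * Lp_norm (torus d) q' g"
        using 3 by auto
      have P'2: "2 \<le> P'" using necessary_half[OF C(2) q'1 C(1)] 3 by simp
      have pP: "1 / P = 1 - 1 / P'" using 3(5) by linarith
      have h: "1 / 2 \<le> 1 / P" unfolding pP using P'2 by (simp add: field_simps)
      show "?L \<le> enn2real (1 / p)"
        using assms(2,4)
      proof (cases rule: ennreal_conjugate_cases)
        case 1
        then show ?thesis using h ip by simp
      next
        case 2
        \<comment> \<open>For q = \<top> no constant works with a finite p', so the assumed
          boundedness is contradictory.\<close>
        then show ?thesis using not_bounded_L1[of P' C] C 3 by auto
      next
        case q: (3 Q Q')
        show ?thesis
        proof (cases "2 \<le> Q")
          case True
          then have "gen_binomial Q (Q / 2) powr (1 / Q) \<le> 2 powr (1 - 1 / P')"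
            using necessary_binomial[of Q' P' C Q] C q 3 by auto
          then show ?thesis using True q log_binomial_le_iff[OF True, of "1 / P"] by (simp add: ip pP)
        next
          case False
          then have "\<not> 2 \<le> q" using q by simp
          then show ?thesis using h ip q by simp
        qed
      qed
    next
      assume A: "?L \<le> enn2real (1 / p)"
      then have "1 / 2 \<le> 1 / P" using L2 ip by linarith
      then have P2: "P \<le> 2" using 3 by (simp add: field_simps)
      have "Lp_norm (count_space (cube d)) p' (fourier_coeff d g) \<le> 2 * Lp_norm (torus d) q' g"
        if g: "g \<in> Lp_space (torus d) q'" for d g
      proof (cases "2 \<le> q")
        \<comment> \<open>For q < 2 the exponent q' is at least 2, so \<open>g\<close> is also in
          the space of exponent 2. The bound for q = 2 applies, where the binomial coefficient is 2
          and the condition reads p <= 2.\<close>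
        case False
        interpret prob_space "torus d" by (rule prob_space_torus)
        have "ennreal 2 \<le> q'"
          using assms(2,4)
        proof (cases rule: ennreal_conjugate_cases)
          case q: (3 a b)
          then have "a < 2" using False by simp
          then have "1 / 2 < 1 / a" using q by (simp add: field_simps)
          then have "1 / b \<le> 1 / 2" using q by linarith
          then show ?thesis using q by (simp add: field_simps)
        qed (use False in auto)
        from Lp_space_mono[OF _ this g]
        have g2: "g \<in> Lp_space (torus d) (ennreal 2)" "Lp_norm (torus d) (ennreal 2) g \<le> Lp_norm (torus d) q' g"
          by auto
        note gen_binomial_two
        moreover have "2 powr 1 \<le> 2 powr (2 / P)" using P2 3 by (intro powr_mono) auto
        ultimately have "Lp_norm (count_space (cube d)) (ennreal P') (fourier_coeff d g) \<le> 2 * Lp_norm (torus d) (ennreal 2) g"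
          using 3 P2 g2(1) by (intro fourier_restriction_bound[of 2 P]) auto
        then show ?thesis using g2(2) 3 by simp
      next
        case True
        show ?thesis
          using assms(2,4)
        proof (cases rule: ennreal_conjugate_cases)
          case 2
          \<comment> \<open>For q = \<top> the condition asks for p <= 1, which is incompatible with
            the present case \<open>1 < P\<close>.\<close>
          then have "1 \<le> 1 / P" using A ip by simp
          then show ?thesis using 3(3) by simp
        next
          case q: (3 Q Q')
          have Q: "2 \<le> Q" using True q by simp
          have "gen_binomial Q (Q / 2) powr (1 / Q) \<le> 2 powr (1 / P)"
            using A q True log_binomial_le_iff[OF Q, of "1 / P"] by (simp add: ip)
          then have "(gen_binomial Q (Q / 2) powr (1 / Q)) powr Q \<le> (2 powr (1 / P)) powr Q"
            using Q by (intro powr_mono2) auto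
          then have "gen_binomial Q (Q / 2) \<le> 2 powr (Q / P)"
            using Q gen_binomial_bounds(3)[OF Q] by (simp add: powr_powr)
          then show ?thesis
            using fourier_restriction_bound[OF Q _ P2, of P' Q' g d] 3 q g by simp
        qed (use True in simp)
      qed
      then show ?bounded by (intro exI[of _ 2]) auto
    qed
  qed
qed

end
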